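(* Let $u,\psi\in\mathcal{H}(\mathbb{C})$ be such that $u$ is not identically zero and $\psi$ is not a constant, let $1\leq p,q\leq\infty$ and $n\in\{0,1,2,\dots\}$. If $D_{(u,\psi,n)}:\mathcal{F}_p\to\mathcal{F}_q$ is bounded and has closed range, then $p=q$.
   Context: $\mathcal{H}(\mathbb{C})$ denotes the set of entire functions on $\mathbb{C}$ and $A$ is the Lebesgue area measure. The Fock space is $\mathcal{F}_p=\{f\in\mathcal{H}(\mathbb{C}):\|f\|_p<\infty\}$, where $\|f\|_p=\big(\frac{p}{2\pi}\int_{\mathbb{C}}|f(z)|^pe^{-\frac p2|z|^2}dA(z)\big)^{1/p}$ for $1\leq p<\infty$ and $\|f\|_\infty=\sup_{z\in\mathbb{C}}|f(z)|e^{-\frac12|z|^2}$. For $u,\psi\in\mathcal{H}(\mathbb{C})$ and $n\in\{0,1,2,\dots\}$, the weighted composition–differentiation operator is $D_{(u,\psi,n)}f=u\cdot(f^{(n)}\circ\psi)$, where $f^{(n)}$ is the $n$-th derivative and $f^{(0)}=f$. *)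

theory Defs
  imports "HOL-Complex_Analysis.Complex_Analysis"
begin

text \<open>The \<open>r\<close>-th power of the norm of \<open>\<F>\<^sub>r\<close>, for a finite real exponent \<open>r\<close>.
  The area measure on the complex plane is \<^const>\<open>lborel\<close>.\<close>

definition fock_integral :: "real \<Rightarrow> (complex \<Rightarrow> complex) \<Rightarrow> ennreal" where
  "fock_integral r f =
     ennreal (r / (2 * pi)) *
     (\<integral>\<^sup>+ z. ennreal (norm (f z) powr r * exp (- (r / 2) * (norm z)\<^sup>2)) \<partial>lborel)"

text \<open>The exponent \<open>p\<close> is meant to satisfy \<open>1 \<le> p\<close>, with \<open>p = \<infinity>\<close> allowed. The norm may be
  \<open>\<infinity>\<close>. The inner case distinction extends the real root \<open>t powr (1 / r)\<close> to \<open>t = \<infinity>\<close>.\<close>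

definition fock_norm :: "ennreal \<Rightarrow> (complex \<Rightarrow> complex) \<Rightarrow> ennreal" where
  "fock_norm p f =
     (if p = \<infinity> then (SUP z. ennreal (norm (f z) * exp (- (1 / 2) * (norm z)\<^sup>2)))
      else if fock_integral (enn2real p) f = \<infinity> then \<infinity>
      else ennreal (enn2real (fock_integral (enn2real p) f) powr (1 / enn2real p)))"

definition fock_space :: "ennreal \<Rightarrow> (complex \<Rightarrow> complex) set" where
  "fock_space p = {f. f holomorphic_on UNIV \<and> fock_norm p f < \<infinity>}"

definition fock_dist :: "ennreal \<Rightarrow> (complex \<Rightarrow> complex) \<Rightarrow> (complex \<Rightarrow> complex) \<Rightarrow> real" where
  "fock_dist p f g = enn2real (fock_norm p (\<lambda>z. f z - g z))"

definition weighted_comp_diff ::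
  "(complex \<Rightarrow> complex) \<Rightarrow> (complex \<Rightarrow> complex) \<Rightarrow> nat \<Rightarrow> (complex \<Rightarrow> complex) \<Rightarrow> complex \<Rightarrow> complex"
where
  "weighted_comp_diff u \<psi> n f = (\<lambda>z. u z * (deriv ^^ n) f (\<psi> z))"

definition fock_bounded ::
  "ennreal \<Rightarrow> ennreal \<Rightarrow> ((complex \<Rightarrow> complex) \<Rightarrow> complex \<Rightarrow> complex) \<Rightarrow> bool"
where
  "fock_bounded p q T \<longleftrightarrow>
     T ` fock_space p \<subseteq> fock_space q \<and>
     (\<exists>C::real. \<forall>f\<in>fock_space p. fock_norm q (T f) \<le> ennreal C * fock_norm p f)"

definition fock_closed_range ::
  "ennreal \<Rightarrow> ennreal \<Rightarrow> ((complex \<Rightarrow> complex) \<Rightarrow> complex \<Rightarrow> complex) \<Rightarrow> bool"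
where
  "fock_closed_range p q T \<longleftrightarrow>
     closedin (Metric_space.mtopology (fock_space q) (fock_dist q)) (T ` fock_space p)"

text \<open>The rest shows that \<^const>\<open>fock_dist\<close> is a metric on \<^const>\<open>fock_space\<close>, so that
  \<^const>\<open>fock_closed_range\<close> refers to the norm topology.\<close>

lemma fock_norm_le_iff:
  assumes "p \<noteq> \<infinity>" "1 \<le> p" "0 \<le> a"
  shows "fock_norm p f \<le> ennreal a \<longleftrightarrow>
           fock_integral (enn2real p) f \<le> ennreal (a powr enn2real p)"
proof -
  obtain r where r: "p = ennreal r" "r \<ge> 1"
    using assms(1,2) by (cases p) (auto simp: infinity_ennreal_def simp flip: ennreal_1)
  have *: "t powr (1 / r) \<le> a \<longleftrightarrow> t \<le> a powr r" if "t \<ge> 0" for t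
  proof
    assume "t powr (1 / r) \<le> a"
    then have "(t powr (1 / r)) powr r \<le> a powr r"
      using r by (intro powr_mono2) auto
    then show "t \<le> a powr r" using r that by (simp add: powr_powr)
  next
    assume "t \<le> a powr r"
    then have "t powr (1 / r) \<le> (a powr r) powr (1 / r)"
      using r that by (intro powr_mono2) auto
    then show "t powr (1 / r) \<le> a" using r assms(3) by (simp add: powr_powr)
  qed
  show ?thesis
    using r assms(3)
    by (cases "fock_integral r f")
       (auto simp: fock_norm_def * top_unique infinity_ennreal_def)
qed

lemma powr_sum_le:
  fixes a b x y r :: real
  assumes "r \<ge> 1" "a > 0" "b > 0" "x \<ge> 0" "y \<ge> 0"
  shows "(x + y) powr r \<le>
    (a + b) powr r * ((a / (a + b)) * a powr (-r) * x powr r + (b / (a + b)) * b powr (-r) * y powr r)"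
proof -
  have cvx: "(\<lambda>x. x powr r) ((1 - t) *\<^sub>R s1 + t *\<^sub>R s2) \<le> (1 - t) * s1 powr r + t * s2 powr r"
    if "s1 > 0" "s2 > 0" "0 \<le> t" "t \<le> 1" for s1 s2 t :: real
    using convex_onD[OF powr_convex[OF assms(1)], of t s1 s2] that by simp
  have cvx0: "(t * s) powr r \<le> t * s powr r" if "0 \<le> s" "0 \<le> t" "t \<le> 1" for s t :: real
  proof (cases "t = 0")
    case False
    then have "t powr r \<le> t powr 1" using that assms(1) by (intro powr_mono') auto
    then show ?thesis using that False by (simp add: powr_mult mult_right_mono)
  qed auto
  define t where "t = b / (a + b)"
  have t: "0 < t" "t < 1" "1 - t = a / (a + b)"
    using assms by (auto simp: t_def field_simps)
  have eq: "x + y = (a + b) * ((1 - t) * (x / a) + t * (y / b))"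
  proof -
    have "(a + b) * ((1 - t) * (x / a) + t * (y / b)) = ((a+b)*(1-t)) * (x/a) + ((a+b)*t)*(y/b)"
      by (simp only: distrib_left mult.assoc)
    also have "(a+b)*(1-t) = a" using assms by (simp add: t(3))
    also have "(a+b)*t = b" using assms by (simp add: t_def)
    finally have "(a + b) * ((1 - t) * (x / a) + t * (y / b)) = a * (x / a) + b * (y / b)" .
    moreover have "a * (x / a) = x" "b * (y / b) = y" using assms by auto
    ultimately show ?thesis by argo
  qed
  have main: "((1 - t) * (x / a) + t * (y / b)) powr r
        \<le> (1 - t) * (x / a) powr r + t * (y / b) powr r"
  proof -
    consider "x = 0" | "y = 0" | "x > 0" "y > 0" using assms by linarith
    then show ?thesis
    proof cases
      case 1 then show ?thesis using cvx0[of "y / b" t] t assms by simp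
    next
      case 2 then show ?thesis using cvx0[of "x / a" "1 - t"] t assms by simp
    next
      case 3 then show ?thesis using cvx[of "x / a" "y / b" t] t assms by simp
    qed
  qed
  have "(x + y) powr r = (a + b) powr r * ((1 - t) * (x / a) + t * (y / b)) powr r"
    using eq assms t by (metis powr_mult)
  also have "\<dots> \<le> (a + b) powr r * ((1 - t) * (x / a) powr r + t * (y / b) powr r)"
    by (intro mult_left_mono main) auto
  also have "(x / a) powr r = a powr (-r) * x powr r"
    using assms by (simp add: powr_divide powr_minus_divide)
  also have "(y / b) powr r = b powr (-r) * y powr r"
    using assms by (simp add: powr_divide powr_minus_divide)
  finally show ?thesis
    unfolding t(3) by (simp only: t_def mult.assoc)
qed

lemma fock_integral_add_le:
  assumes r: "r \<ge> 1" and ab: "a > 0" "b > 0"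
    and [measurable]: "f \<in> borel_measurable borel" "g \<in> borel_measurable borel"
    and f: "fock_integral r f \<le> ennreal (a powr r)"
    and g: "fock_integral r g \<le> ennreal (b powr r)"
  shows "fock_integral r (\<lambda>z. f z + g z) \<le> ennreal ((a + b) powr r)"
proof -
  define A where "A = (a + b) powr r * ((a / (a + b)) * a powr (-r))"
  define B where "B = (a + b) powr r * ((b / (a + b)) * b powr (-r))"
  define w where "w z = exp (- (r / 2) * (norm z)\<^sup>2)" for z :: complex
  have [measurable]: "w \<in> borel_measurable borel" unfolding w_def by measurable
  have A: "A \<ge> 0" "B \<ge> 0" using ab by (auto simp: A_def B_def)
  have pt: "norm (f z + g z) powr r * w z
     \<le> A * (norm (f z) powr r * w z) + B * (norm (g z) powr r * w z)" for z
  proof -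
    have "norm (f z + g z) powr r \<le> (norm (f z) + norm (g z)) powr r"
      using r by (intro powr_mono2 norm_triangle_ineq) auto
    also have "\<dots> \<le> A * norm (f z) powr r + B * norm (g z) powr r"
      using powr_sum_le[OF r ab, of "norm (f z)" "norm (g z)"]
      by (simp add: A_def B_def algebra_simps)
    finally have "norm (f z + g z) powr r * w z
       \<le> (A * norm (f z) powr r + B * norm (g z) powr r) * w z"
      by (intro mult_right_mono) (auto simp: w_def)
    then show ?thesis by (simp add: algebra_simps)
  qed
  have "fock_integral r (\<lambda>z. f z + g z)
     \<le> ennreal (r / (2 * pi)) * (\<integral>\<^sup>+ z. (ennreal A * ennreal (norm (f z) powr r * w z)
          + ennreal B * ennreal (norm (g z) powr r * w z)) \<partial>lborel)"
    unfolding fock_integral_def w_def[symmetric]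
  proof (intro mult_left_mono nn_integral_mono)
    fix z
    show "ennreal (norm (f z + g z) powr r * w z)
       \<le> ennreal A * ennreal (norm (f z) powr r * w z) + ennreal B * ennreal (norm (g z) powr r * w z)"
      using pt[of z] A
      by (simp add: w_def flip: ennreal_mult ennreal_plus)
  qed auto
  also have "\<dots> = ennreal A * fock_integral r f + ennreal B * fock_integral r g"
    unfolding fock_integral_def w_def[symmetric]
    by (simp add: nn_integral_add nn_integral_cmult distrib_left mult_ac)
  also have "\<dots> \<le> ennreal A * ennreal (a powr r) + ennreal B * ennreal (b powr r)"
    by (intro add_mono mult_left_mono f g) auto
  also have "\<dots> = ennreal (A * a powr r + B * b powr r)"
    using A by (simp flip: ennreal_mult ennreal_plus)
  also have "A * a powr r + B * b powr r = (a + b) powr r * (a / (a + b) + b / (a + b))"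
  proof -
    have "a powr (-r) * a powr r = 1" "b powr (-r) * b powr r = 1"
      using ab by (simp_all flip: powr_add)
    then have "A * a powr r = (a + b) powr r * (a / (a + b))"
      "B * b powr r = (a + b) powr r * (b / (a + b))"
      by (simp_all add: A_def B_def mult.assoc)
    then show ?thesis by (simp only: distrib_left)
  qed
  also have "a / (a + b) + b / (a + b) = 1"
    using ab by (simp flip: add_divide_distrib)
  finally show ?thesis by simp
qed

lemma fock_norm_triangle:
  assumes p: "1 \<le> p" and f: "f \<in> borel_measurable borel" and g: "g \<in> borel_measurable borel"
  shows "fock_norm p (\<lambda>z. f z + g z) \<le> fock_norm p f + fock_norm p g"
proof (cases "p = \<infinity>")
  case True
  show ?thesis
    unfolding fock_norm_def using True
  proof (simp, intro SUP_least)
    fix z :: complex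
    let ?e = "exp (- ((norm z)\<^sup>2 / 2))"
    have "ennreal (norm (f z + g z) * ?e) \<le> ennreal (norm (f z) * ?e + norm (g z) * ?e)"
      by (intro ennreal_leI) (simp add: norm_triangle_ineq mult_right_mono flip: distrib_right)
    also have "\<dots> = ennreal (norm (f z) * ?e) + ennreal (norm (g z) * ?e)" by simp
    also have "\<dots> \<le> (SUP z. ennreal (norm (f z) * exp (- ((norm z)\<^sup>2 / 2))))
        + (SUP z. ennreal (norm (g z) * exp (- ((norm z)\<^sup>2 / 2))))"
      by (intro add_mono SUP_upper) auto
    finally show "ennreal (norm (f z + g z) * ?e) \<le> \<dots>" .
  qed
next
  case False
  have r: "enn2real p \<ge> 1"
    using False p by (cases p) (auto simp: infinity_ennreal_def simp flip: ennreal_1)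
  show ?thesis
  proof (cases "fock_norm p f = \<infinity> \<or> fock_norm p g = \<infinity>")
    case True
    then show ?thesis by (auto simp: infinity_ennreal_def)
  next
    case False
    then obtain a b where ab: "fock_norm p f = ennreal a" "a \<ge> 0" "fock_norm p g = ennreal b" "b \<ge> 0"
      by (metis ennreal_cases infinity_ennreal_def)
    have "fock_norm p (\<lambda>z. f z + g z) \<le> ennreal (a + b)"
    proof (rule ennreal_le_epsilon)
      fix e :: real assume e: "0 < e"
      have "fock_integral (enn2real p) f \<le> ennreal ((a + e/2) powr enn2real p)"
        using fock_norm_le_iff[OF \<open>p \<noteq> \<infinity>\<close> p, of "a + e/2" f] ab e by (simp add: ennreal_leI)
      moreover have "fock_integral (enn2real p) g \<le> ennreal ((b + e/2) powr enn2real p)"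
        using fock_norm_le_iff[OF \<open>p \<noteq> \<infinity>\<close> p, of "b + e/2" g] ab e by (simp add: ennreal_leI)
      ultimately have "fock_integral (enn2real p) (\<lambda>z. f z + g z)
          \<le> ennreal ((a + e/2 + (b + e/2)) powr enn2real p)"
        using ab e by (intro fock_integral_add_le r f g) auto
      then have "fock_norm p (\<lambda>z. f z + g z) \<le> ennreal (a + e/2 + (b + e/2))"
        using ab e by (subst fock_norm_le_iff[OF \<open>p \<noteq> \<infinity>\<close> p]) auto
      also have "\<dots> = ennreal (a + b) + ennreal e"
        using ab e by (simp flip: ennreal_plus)
      finally show "fock_norm p (\<lambda>z. f z + g z) \<le> ennreal (a + b) + ennreal e" .
    qed
    then show ?thesis using ab by simp
  qed
qed

lemma fock_norm_uminus: "fock_norm p (\<lambda>z. - f z) = fock_norm p f"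
  by (simp add: fock_norm_def fock_integral_def)

lemma fock_norm_eq_0_imp:
  assumes p: "1 \<le> p" and f: "continuous_on UNIV f" and 0: "fock_norm p f = 0"
  shows "f z = 0"
proof (cases "p = \<infinity>")
  case True
  then have "ennreal (norm (f z) * exp (- (1 / 2) * (norm z)\<^sup>2)) \<le> 0"
    using 0 by (metis (mono_tags, lifting) SUP_upper UNIV_I fock_norm_def)
  then show ?thesis by (simp add: mult_le_0_iff)
next
  case False
  let ?r = "enn2real p"
  have r: "?r \<ge> 1"
    using False p by (cases p) (auto simp: infinity_ennreal_def simp flip: ennreal_1)
  have [measurable]: "f \<in> borel_measurable borel"
    using f by (rule borel_measurable_continuous_onI)
  have "fock_integral ?r f \<le> ennreal (0 powr ?r)"
    using fock_norm_le_iff[OF False p, of 0 f] 0 by simp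
  then have "fock_integral ?r f = 0" by simp
  moreover have "0 < ?r / (2 * pi)" using r by simp
  ultimately have "(\<integral>\<^sup>+ z. ennreal (norm (f z) powr ?r * exp (- (?r / 2) * (norm z)\<^sup>2)) \<partial>lborel) = 0"
    unfolding fock_integral_def by (simp add: ennreal_eq_0_iff)
  then have "AE z in lborel. ennreal (norm (f z) powr ?r * exp (- (?r / 2) * (norm z)\<^sup>2)) = 0"
    by (subst (asm) nn_integral_0_iff_AE) auto
  then have "AE z in lborel. f z = 0"
    by eventually_elim (auto simp: ennreal_eq_0_iff mult_le_0_iff)
  then have ae: "AE z in lebesgue. z \<in> {z. f z = 0}"
    by (intro AE_completion) simp
  have "closed {z. f z = 0}"
    using continuous_closed_preimage_constant[OF f closed_UNIV, of 0] by simp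
  then show ?thesis
    using mem_closed_if_AE_lebesgue_open[of UNIV "{z. f z = 0}" z] ae by auto
qed

lemma fock_space_diff:
  assumes "1 \<le> p" "f \<in> fock_space p" "g \<in> fock_space p"
  shows "(\<lambda>z. f z - g z) \<in> fock_space p"
proof -
  have h: "f holomorphic_on UNIV" "g holomorphic_on UNIV"
    and n: "fock_norm p f < \<infinity>" "fock_norm p g < \<infinity>"
    using assms by (auto simp: fock_space_def)
  have "fock_norm p (\<lambda>z. f z + - g z) \<le> fock_norm p f + fock_norm p (\<lambda>z. - g z)"
    using h by (intro fock_norm_triangle assms borel_measurable_continuous_onI
        holomorphic_on_imp_continuous_on holomorphic_intros)
  then have "fock_norm p (\<lambda>z. f z - g z) < \<infinity>"
    using n by (simp add: fock_norm_uminus le_less_trans)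
  then show ?thesis using h by (auto simp: fock_space_def intro!: holomorphic_intros)
qed

lemma Metric_space_fock:
  assumes "1 \<le> p"
  shows "Metric_space (fock_space p) (fock_dist p)"
proof
  fix f g
  show "0 \<le> fock_dist p f g" by (simp add: fock_dist_def)
  show "fock_dist p f g = fock_dist p g f"
    using fock_norm_uminus[of p "\<lambda>z. f z - g z"] by (simp add: fock_dist_def)
next
  fix f g assume fg: "f \<in> fock_space p" "g \<in> fock_space p"
  then have d: "(\<lambda>z. f z - g z) \<in> fock_space p" by (rule fock_space_diff[OF assms])
  show "fock_dist p f g = 0 \<longleftrightarrow> f = g"
  proof
    assume "fock_dist p f g = 0"
    then have "fock_norm p (\<lambda>z. f z - g z) = 0"
      using d by (auto simp: fock_dist_def fock_space_def enn2real_eq_0_iff)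
    moreover have "continuous_on UNIV (\<lambda>z. f z - g z)"
      using d by (auto simp: fock_space_def intro: holomorphic_on_imp_continuous_on)
    ultimately have "f z - g z = 0" for z using fock_norm_eq_0_imp[OF assms] by blast
    then show "f = g" by auto
  next
    assume "f = g"
    then show "fock_dist p f g = 0" by (simp add: fock_dist_def fock_norm_def fock_integral_def)
  qed
next
  fix f g h assume fgh: "f \<in> fock_space p" "g \<in> fock_space p" "h \<in> fock_space p"
  have d: "(\<lambda>z. f z - g z) \<in> fock_space p" "(\<lambda>z. g z - h z) \<in> fock_space p"
    using fgh by (auto intro: fock_space_diff[OF assms])
  have "fock_norm p (\<lambda>z. (f z - g z) + (g z - h z))
      \<le> fock_norm p (\<lambda>z. f z - g z) + fock_norm p (\<lambda>z. g z - h z)"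
    using d by (intro fock_norm_triangle assms borel_measurable_continuous_onI
        holomorphic_on_imp_continuous_on) (auto simp: fock_space_def)
  then have "fock_norm p (\<lambda>z. f z - h z)
      \<le> fock_norm p (\<lambda>z. f z - g z) + fock_norm p (\<lambda>z. g z - h z)" by simp
  moreover have "fock_norm p (\<lambda>z. f z - g z) < \<infinity>" "fock_norm p (\<lambda>z. g z - h z) < \<infinity>"
    using d by (auto simp: fock_space_def)
  ultimately show "fock_dist p f h \<le> fock_dist p f g + fock_dist p g h"
    unfolding fock_dist_def
    by (subst enn2real_plus[symmetric]) (auto intro!: enn2real_mono simp: infinity_ennreal_def less_top)
qed

end

(* The exponent is read off from how fast norms of sums of N normalised reproducing kernels grow.
  Take k_j centred at consecutive integers w_j of the real axis. At every point z the numbers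
  |k_j(z)|, and likewise |(T k_j)(z)| for T = D_(u,psi,n), form a log-concave sequence in j with
  second logarithmic difference at most -1, so their sum is comparable to their maximum. Hence every
  signed sum of N of the k_j (respectively T k_j) has norm at most of order N^(1/p) (respectively
  N^(1/q)), and by averaging over the signs some signed sum has norm at least of that order.
  Boundedness of T gives 1/q <= 1/p. Closed range gives, by Baire's theorem, a lower bound for T
  modulo its kernel, which consists of the polynomials of degree < n; the test functions have small
  Taylor coefficients at 0, so this suffices for 1/p <= 1/q. *)

theory Submission
  imports Defs "HOL-Probability.Distributions"
begin

text \<open>Both comparisons of exponents need two-sided control of the single images: the norm of T
  k_j is bounded above because T is bounded, and bounded away from 0 because the range is closed.
  The second fact enters 1/q <= 1/p as well, since a merely bounded operator may send the k_j to
  functions whose norms tend to 0. With a real centre w one has |T k_w (z)| = |u(z)| w^n exp(w Re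
  psi(z) - w^2/2). For each fixed z this is a Gaussian profile in w times a log-concave power,
  whatever u and psi are; only the place of its peak varies with z. The phases of the T k_j (z) are
  not controlled, and neighbouring terms of comparable modulus may cancel, so no fixed sum has an
  evident lower bound. Averaging over signs avoids this. It costs nothing on the other side, where
  the upper bound holds for every choice of signs and hence for the one that the averaging
  selects.\<close>

lemma enn2real_ge_1:
  assumes "1 \<le> p" "p \<noteq> \<infinity>"
  shows "1 \<le> enn2real p"
  using assms by (cases p) (auto simp: infinity_ennreal_def simp flip: ennreal_1)

lemma borel_measurable_entire:
  fixes f :: "complex \<Rightarrow> complex"
  assumes "f holomorphic_on UNIV"
  shows "f \<in> borel_measurable borel"
  using assms by (intro borel_measurable_continuous_onI holomorphic_on_imp_continuous_on)

text \<open>The weighted modulus |f(z)| exp(-|z|^2/2), which also occurs in the supremum norm, is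
  isolated, so that one pointwise estimate of it serves all exponents.\<close>

lemma fock_integral_eq_powr:
  "fock_integral r f =
     ennreal (r / (2 * pi)) * (\<integral>\<^sup>+ z. ennreal ((norm (f z) * exp (- (norm z)\<^sup>2 / 2)) powr r) \<partial>lborel)"
proof -
  have "norm (f z) powr r * exp (- (r / 2) * (norm z)\<^sup>2) = (norm (f z) * exp (- (norm z)\<^sup>2 / 2)) powr r" for z
    by (simp add: powr_mult powr_def[of "exp _"] mult.commute)
  then show ?thesis by (simp add: fock_integral_def)
qed

section \<open>Homogeneity and lower semicontinuity of the norm\<close>

lemma fock_norm_cmult:
  assumes p: "1 \<le> p" and [measurable]: "f \<in> borel_measurable borel"
  shows "fock_norm p (\<lambda>z. c * f z) = ennreal (norm c) * fock_norm p f"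
proof (cases "p = \<infinity>")
  case True
  then show ?thesis
    by (simp add: fock_norm_def norm_mult mult.assoc ennreal_mult SUP_mult_left_ennreal)
next
  case False
  define r where "r = enn2real p"
  have r: "1 \<le> r" unfolding r_def using enn2real_ge_1[OF p False] .
  have I: "fock_integral r (\<lambda>z. c * f z) = ennreal (norm c powr r) * fock_integral r f"
    unfolding fock_integral_def norm_mult
    by (simp add: powr_mult mult.assoc ennreal_mult nn_integral_cmult mult.left_commute)
  show ?thesis
  proof (cases "c = 0")
    case True
    then show ?thesis using r by (simp add: fock_norm_def fock_integral_def)
  next
    case c: False
    show ?thesis
    proof (cases "fock_integral r f")
      case (real t)
      have "(norm c powr r * t) powr (1 / r) = norm c * t powr (1 / r)"
        using real r by (simp add: powr_mult powr_powr)
      moreover have "fock_integral r (\<lambda>z. c * f z) = ennreal (norm c powr r * t)"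
        using I real by (simp add: ennreal_mult)
      ultimately have "fock_norm p (\<lambda>z. c * f z) = ennreal (norm c * t powr (1 / r))"
        using False real by (simp add: fock_norm_def r_def[symmetric] infinity_ennreal_def)
      moreover have "fock_norm p f = ennreal (t powr (1 / r))"
        using False real by (simp add: fock_norm_def r_def[symmetric] infinity_ennreal_def)
      ultimately show ?thesis by (simp add: ennreal_mult)
    next
      case top
      then have "fock_integral r (\<lambda>z. c * f z) = \<infinity>"
        using I c by (simp add: ennreal_mult_top infinity_ennreal_def)
      then show ?thesis
        using False top c
        by (simp add: fock_norm_def r_def[symmetric] infinity_ennreal_def ennreal_mult_top)
    qed
  qed
qed

text \<open>Fatou's lemma if \<open>p\<close> is finite, a limit at each point if it is infinite.
  This keeps Montel limits inside the space and turns the Cauchy condition into convergence in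
  norm.\<close>

lemma fock_norm_le_of_tendsto:
  assumes p: "1 \<le> p" and a: "0 \<le> a" and [measurable]: "\<And>k. f k \<in> borel_measurable borel"
    and le: "\<And>k::nat. fock_norm p (f k) \<le> ennreal a"
    and lim: "\<And>z. (\<lambda>k. f k z) \<longlonglongrightarrow> g z"
  shows "fock_norm p g \<le> ennreal a"
proof (cases "p = \<infinity>")
  case True
  show ?thesis
    unfolding fock_norm_def using True
  proof (simp, intro SUP_least)
    fix z
    have "ennreal (norm (f k z) * exp (- ((norm z)\<^sup>2 / 2))) \<le> ennreal a" for k
      using le[of k] True unfolding fock_norm_def by (simp add: SUP_le_iff)
    then have "norm (f k z) * exp (- ((norm z)\<^sup>2 / 2)) \<le> a" for k
      using a by (simp add: ennreal_le_iff)
    then have ev: "\<exists>N. \<forall>k\<ge>N. norm (f k z) * exp (- ((norm z)\<^sup>2 / 2)) \<le> a" by blast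
    have "(\<lambda>k. norm (f k z) * exp (- ((norm z)\<^sup>2 / 2)))
        \<longlonglongrightarrow> norm (g z) * exp (- ((norm z)\<^sup>2 / 2))"
      by (intro tendsto_intros lim)
    then have "norm (g z) * exp (- ((norm z)\<^sup>2 / 2)) \<le> a"
      using ev by (rule LIMSEQ_le_const2)
    then show "ennreal (norm (g z) * exp (- ((norm z)\<^sup>2 / 2))) \<le> ennreal a"
      by (rule ennreal_leI)
  qed
next
  case False
  define r where "r = enn2real p"
  have r: "1 \<le> r" unfolding r_def using enn2real_ge_1[OF p False] .
  have [measurable]: "g \<in> borel_measurable borel"
    by (rule borel_measurable_LIMSEQ_metric[OF _ lim]) auto
  have le': "fock_integral r (f k) \<le> ennreal (a powr r)" for k
    using le fock_norm_le_iff[OF False p a] by (simp add: r_def)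
  let ?h = "\<lambda>f z. ennreal (r / (2 * pi)) * ennreal (norm (f z :: complex) powr r * exp (- (r / 2) * (norm (z::complex))\<^sup>2))"
  have eq: "fock_integral r h = (\<integral>\<^sup>+ z. ?h h z \<partial>lborel)"
    if [measurable]: "h \<in> borel_measurable borel" for h
    by (simp add: fock_integral_def nn_integral_cmult)
  have lim': "(\<lambda>k. ?h (f k) z) \<longlonglongrightarrow> ?h g z" for z
    using r by (intro ennreal_tendsto_cmult tendsto_intros lim) auto
  have "fock_integral r g = (\<integral>\<^sup>+ z. liminf (\<lambda>k. ?h (f k) z) \<partial>lborel)"
    unfolding eq[OF \<open>g \<in> _\<close>] by (intro nn_integral_cong lim_imp_Liminf[symmetric] lim') simp
  also have "\<dots> \<le> liminf (\<lambda>k. \<integral>\<^sup>+ z. ?h (f k) z \<partial>lborel)"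
    by (intro nn_integral_liminf) simp
  also have "\<dots> \<le> ennreal (a powr r)"
    by (intro Liminf_le) (use le' eq in auto)
  finally show ?thesis
    using fock_norm_le_iff[OF False p a] by (simp add: r_def)
qed

section \<open>Gaussian integrals and monomials\<close>

lemma nn_integral_gaussian_complex_finite:
  assumes "0 < a"
  shows "(\<integral>\<^sup>+ z. ennreal (exp (- a * (norm (z::complex))\<^sup>2)) \<partial>lborel) < \<infinity>"
proof -
  have one: "(\<integral>\<^sup>+ x. ennreal (exp (- a * (x::real)\<^sup>2)) \<partial>lborel) < \<infinity>"
  proof -
    \<comment> \<open>The variance for which the exponent of the normal density at \<open>x\<close>
      is \<open>- a * x^2\<close>; the Gaussian is then a constant multiple of a probability
      density.\<close>
    define \<sigma> where "\<sigma> = 1 / sqrt (2 * a)"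
    have s: "\<sigma> > 0" "2 * \<sigma>\<^sup>2 = 1 / a"
      using assms by (auto simp: \<sigma>_def power_divide)
    have eq: "exp (- a * x\<^sup>2) = sqrt (2 * pi * \<sigma>\<^sup>2) * normal_density 0 \<sigma> x" for x
      using s assms by (simp add: normal_density_def mult.commute)
    have "integrable lborel (\<lambda>x. sqrt (2 * pi * \<sigma>\<^sup>2) * normal_density 0 \<sigma> x)"
      using s by (intro integrable_mult_right) auto
    then have "integrable lborel (\<lambda>x. exp (- a * x\<^sup>2))"
      by (simp only: eq)
    then show ?thesis
      by (subst (asm) integrable_iff_bounded) auto
  qed
  have "(\<integral>\<^sup>+ z. ennreal (exp (- a * (norm (z::complex))\<^sup>2)) \<partial>lborel)
     = (\<integral>\<^sup>+ z. (\<Prod>b\<in>(Basis::complex set). ennreal (exp (- a * (z \<bullet> b)\<^sup>2))) \<partial>lborel)"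
  proof (intro nn_integral_cong)
    fix z :: complex
    show "ennreal (exp (- a * (norm z)\<^sup>2)) = (\<Prod>b\<in>Basis. ennreal (exp (- a * (z \<bullet> b)\<^sup>2)))"
      by (simp add: Basis_complex_def cmod_power2 distrib_left mult_exp_exp inner_complex_def
          flip: ennreal_mult)
  qed
  also have "\<dots> = (\<Prod>b\<in>(Basis::complex set). (\<integral>\<^sup>+ x. ennreal (exp (- a * x\<^sup>2)) \<partial>lborel))"
    by (rule nn_integral_lborel_prod) auto
  also have "\<dots> < \<infinity>"
    using one by (simp add: infinity_ennreal_def power_less_top_ennreal)
  finally show ?thesis .
qed

lemma power_div_fact_le_exp:
  fixes x :: real
  assumes "0 \<le> x"
  shows "x ^ n / fact n \<le> exp x"
proof -
  have "(\<Sum>k\<in>{n}. x ^ k /\<^sub>R fact k) \<le> (\<Sum>k. x ^ k /\<^sub>R fact k)"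
    using exp_converges[of x] assms by (intro sum_le_suminf) (auto simp: sums_iff)
  then show ?thesis
    using exp_converges[of x] by (simp add: sums_iff divide_inverse mult.commute)
qed

text \<open>Half of the Gaussian weight absorbs the power and the other half remains integrable. The
  monomials span the kernel of the operator, and \<open>i = 0\<close> gives the constant 1 that
  serves as unit of measurement for the test functions.\<close>

lemma monomial_in_fock_space:
  assumes p: "1 \<le> p"
  shows "(\<lambda>z. z ^ i) \<in> fock_space p"
proof -
  \<comment> \<open>The i-th term of the series of exp(|z|^2/4) gives |z|^(2i) <= 4^i i!
    exp(|z|^2/4); the summand 1 pays for passing from |z|^i to |z|^(2i).\<close>
  define C :: real where "C = 1 + 4 ^ i * fact i"
  have C: "0 \<le> C" by (simp add: C_def)
  have bound: "norm (z ^ i) * exp (- (norm z)\<^sup>2 / 2) \<le> C * exp (- (norm z)\<^sup>2 / 4)" for z :: complex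
  proof -
    have "((norm z)\<^sup>2 / 4) ^ i / fact i \<le> exp ((norm z)\<^sup>2 / 4)"
      by (rule power_div_fact_le_exp) simp
    then have "(norm z) ^ (2 * i) \<le> 4 ^ i * fact i * exp ((norm z)\<^sup>2 / 4)"
      by (simp add: field_simps power_divide flip: power_mult)
    moreover have "(norm z) ^ i \<le> 1 + (norm z) ^ (2 * i)"
    proof -
      have "x \<le> 1 + x\<^sup>2" for x :: real
        by (cases "x \<le> 1") (auto simp: power2_eq_square intro: order_trans[of _ 1] add_increasing mult_left_le)
      from this[of "norm z ^ i"] show ?thesis by (simp add: power_mult mult.commute flip: power_mult)
    qed
    moreover have "1 \<le> exp ((norm z)\<^sup>2 / 4)" by simp
    ultimately have "(norm z) ^ i \<le> C * exp ((norm z)\<^sup>2 / 4)"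
      unfolding C_def distrib_right by linarith
    then have "(norm z) ^ i * exp (- (norm z)\<^sup>2 / 2) \<le> C * exp ((norm z)\<^sup>2 / 4) * exp (- (norm z)\<^sup>2 / 2)"
      by (intro mult_right_mono) auto
    also have "\<dots> = C * exp (- (norm z)\<^sup>2 / 4)" by (simp add: mult.assoc mult_exp_exp)
    finally show ?thesis by (simp add: norm_power)
  qed
  have "fock_norm p (\<lambda>z. z ^ i) < \<infinity>"
  proof (cases "p = \<infinity>")
    case True
    have "norm (z ^ i) * exp (- (1 / 2) * (norm z)\<^sup>2) \<le> C" for z :: complex
    proof -
      have "C * exp (- (norm z)\<^sup>2 / 4) \<le> C * 1" using C by (intro mult_left_mono) auto
      then show ?thesis using bound[of z] by simp
    qed
    then have "fock_norm p (\<lambda>z. z ^ i) \<le> ennreal C"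
      unfolding fock_norm_def using True by (auto intro!: SUP_least ennreal_leI)
    then show ?thesis by (simp add: le_less_trans)
  next
    case False
    define r where "r = enn2real p"
    have r: "1 \<le> r" unfolding r_def using enn2real_ge_1[OF p False] .
    have "fock_integral r (\<lambda>z. z ^ i)
      \<le> ennreal (r / (2 * pi)) * (\<integral>\<^sup>+ z. ennreal (C powr r) * ennreal (exp (- (r / 4) * (norm (z::complex))\<^sup>2)) \<partial>lborel)"
      unfolding fock_integral_eq_powr
    proof (intro mult_left_mono nn_integral_mono)
      fix z :: complex
      have "(norm (z ^ i) * exp (- (norm z)\<^sup>2 / 2)) powr r \<le> (C * exp (- (norm z)\<^sup>2 / 4)) powr r"
        using r bound by (intro powr_mono2) auto
      also have "\<dots> = C powr r * exp (- (r / 4) * (norm z)\<^sup>2)"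
        using C by (simp add: powr_mult powr_def[of "exp _"])
      finally show "ennreal ((norm (z ^ i) * exp (- (norm z)\<^sup>2 / 2)) powr r)
         \<le> ennreal (C powr r) * ennreal (exp (- (r / 4) * (norm z)\<^sup>2))"
        by (simp add: ennreal_leI flip: ennreal_mult)
    qed simp
    also have "\<dots> = ennreal (r / (2 * pi)) * (ennreal (C powr r) * (\<integral>\<^sup>+ z. ennreal (exp (- (r / 4) * (norm (z::complex))\<^sup>2)) \<partial>lborel))"
      by (subst nn_integral_cmult) auto
    also have "\<dots> < \<infinity>"
      using nn_integral_gaussian_complex_finite[of "r / 4"] r
      by (simp add: ennreal_mult_less_top infinity_ennreal_def)
    finally show ?thesis
      using False unfolding fock_norm_def r_def[symmetric] by (auto simp: infinity_ennreal_def)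
  qed
  then show ?thesis by (auto simp: fock_space_def intro!: holomorphic_intros)
qed

section \<open>Point evaluations\<close>

text \<open>Cauchy's formula on the circle of radius 2 about \<open>c\<close>, which stays at
  distance at least 1 from \<open>z\<close>; the factor 2 is the ratio of these lengths. The centre
  differs from \<open>z\<close> so that it can be varied afterwards.\<close>

lemma norm_entire_le_circle_average:
  assumes f: "f holomorphic_on UNIV" and c: "c \<in> ball z 1"
  shows "ennreal (norm (f z))
    \<le> 2 * (\<integral>\<^sup>+ t. ennreal (norm (f (c + 2 * cis (2 * pi * t)))) * indicator {0..1} t \<partial>lborel)"
proof -
  define \<gamma> where "\<gamma> = circlepath c 2"
  have \<gamma>: "\<gamma> t = c + 2 * cis (2 * pi * t)" for t
    by (simp add: \<gamma>_def circlepath cis_conv_exp mult_ac)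
  have vd: "vector_derivative \<gamma> (at t within {0..1}) = 2 * pi * \<i> * (2 * cis (2 * pi * t))" if "t \<in> {0..1}" for t
    using that unfolding \<gamma>_def by (simp add: vector_derivative_circlepath01 cis_conv_exp mult_ac)
  have contf: "continuous_on UNIV f" using f by (rule holomorphic_on_imp_continuous_on)
  have cont: "continuous_on {0..1} (\<lambda>t. norm (f (\<gamma> t)))"
    unfolding \<gamma> by (intro continuous_intros continuous_on_compose2[OF contf]) auto
  define I where "I = integral {0..1} (\<lambda>t. norm (f (\<gamma> t)))"
  have I: "((\<lambda>t. norm (f (\<gamma> t))) has_integral I) {0..1}"
    unfolding I_def by (rule integrable_integral[OF integrable_continuous_real[OF cont]])
  have "((\<lambda>w. f w / (w - z)) has_contour_integral (2 * of_real pi * \<i> * f z)) \<gamma>"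
    unfolding \<gamma>_def using c
    by (intro Cauchy_integral_circlepath_simple holomorphic_on_subset[OF f]) (auto simp: dist_norm norm_minus_commute)
  then have C: "((\<lambda>t. f (\<gamma> t) / (\<gamma> t - z) * vector_derivative \<gamma> (at t within {0..1}))
      has_integral (2 * of_real pi * \<i> * f z)) {0..1}"
    by (simp add: has_contour_integral_def)
  have "norm (2 * of_real pi * \<i> * f z) \<le> 4 * pi * I"
  proof -
    have "norm (integral {0..1} (\<lambda>t. f (\<gamma> t) / (\<gamma> t - z) * vector_derivative \<gamma> (at t within {0..1})))
      \<le> integral {0..1} (\<lambda>t. 4 * pi * norm (f (\<gamma> t)))"
    proof (rule Henstock_Kurzweil_Integration.integral_norm_bound_integral)
      fix t :: real assume t: "t \<in> {0..1}"
      have "2 = norm (\<gamma> t - c)" by (simp add: \<gamma> norm_mult)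
      also have "\<dots> \<le> norm (\<gamma> t - z) + norm (z - c)"
        using norm_triangle_ineq[of "\<gamma> t - z" "z - c"] by simp
      finally have ge: "1 \<le> norm (\<gamma> t - z)" using c by (simp add: dist_norm)
      then have "norm (f (\<gamma> t)) / norm (\<gamma> t - z) \<le> norm (f (\<gamma> t))"
        by (simp add: divide_le_eq mult_left_le_one_le mult_ge1_I mult_le_cancel_left1)
      then have "norm (f (\<gamma> t)) / norm (\<gamma> t - z) * (4 * pi) \<le> norm (f (\<gamma> t)) * (4 * pi)"
        by (intro mult_right_mono) auto
      then show "norm (f (\<gamma> t) / (\<gamma> t - z) * vector_derivative \<gamma> (at t within {0..1}))
          \<le> 4 * pi * norm (f (\<gamma> t))"
        by (simp add: vd[OF t] norm_mult norm_divide mult_ac)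
    qed (use C I in \<open>auto simp: integrable_on_def intro: has_integral_mult_right\<close>)
    then show ?thesis
      using C I by (simp add: integral_unique has_integral_integrable I_def[symmetric])
  qed
  then have "norm (f z) \<le> 2 * I" by (simp add: norm_mult)
  moreover have "(\<integral>\<^sup>+ t. ennreal (norm (f (\<gamma> t))) * indicator {0..1} t \<partial>lborel) = ennreal I"
    by (rule nn_integral_has_integral_lebesgue'[OF _ I]) simp
  moreover have "0 \<le> I" using I by (rule has_integral_nonneg) simp
  ultimately show ?thesis
    unfolding \<gamma>[symmetric] by (simp add: ennreal_leI flip: ennreal_mult ennreal_numeral)
qed

text \<open>Averaging the circles of radius 2 over their centres turns a bound by contour integrals into one by
  area integrals without polar coordinates.\<close>

lemma norm_entire_le_area_average:
  assumes f: "f holomorphic_on UNIV"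
  shows "emeasure lborel (ball z 1) * ennreal (norm (f z))
    \<le> 2 * (\<integral>\<^sup>+ w. ennreal (norm (f w)) * indicator (ball z 4) w \<partial>lborel)"
proof -
  note [measurable] = borel_measurable_entire[OF f]
  define e where "e t = 2 * cis (2 * pi * t)" for t
  have [measurable]: "e \<in> borel_measurable borel"
    unfolding e_def by (intro borel_measurable_continuous_onI continuous_intros)
  have [measurable]: "ball z 4 \<in> sets borel" by simp
  define G where "G w = ennreal (norm (f w)) * indicator (ball z 4) w" for w
  have [measurable]: "G \<in> borel_measurable borel" unfolding G_def by measurable
  have "emeasure lborel (ball z 1) * ennreal (norm (f z))
      = (\<integral>\<^sup>+ c. ennreal (norm (f z)) * indicator (ball z 1) c \<partial>lborel)"
    by (simp add: nn_integral_cmult_indicator mult.commute)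
  also have "\<dots> \<le> (\<integral>\<^sup>+ c. 2 * (\<integral>\<^sup>+ t. G (c + e t) * indicator {0..1} t \<partial>lborel) \<partial>lborel)"
  proof (intro nn_integral_mono)
    fix c
    show "ennreal (norm (f z)) * indicator (ball z 1) c
        \<le> 2 * (\<integral>\<^sup>+ t. G (c + e t) * indicator {0..1} t \<partial>lborel)"
    proof (cases "c \<in> ball z 1")
      case True
      \<comment> \<open>\<open>c\<close> is within 1 of \<open>z\<close> and \<open>e t\<close> has
        modulus 2.\<close>
      have "dist z (c + e t) < 4" for t
        using True norm_triangle_ineq4[of "z - c" "e t"] by (simp add: dist_norm norm_mult diff_diff_eq e_def)
      then show ?thesis
        unfolding indicator_simps(1)[OF True] using norm_entire_le_circle_average[OF f True]
        by (simp add: e_def G_def)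
    qed simp
  qed
  also have "\<dots> = 2 * (\<integral>\<^sup>+ t. (\<integral>\<^sup>+ c. G (c + e t) * indicator {0..1} t \<partial>lborel) \<partial>lborel)"
    by (subst nn_integral_cmult) (auto simp: lborel_pair.Fubini'[of "\<lambda>c t. G (c + e t) * indicator {0..1} t"])
  \<comment> \<open>For fixed \<open>t\<close> the inner integral is taken over a translate of
    \<open>G\<close>, so it has the same value for all \<open>t\<close>.\<close>
  also have "\<dots> = 2 * (\<integral>\<^sup>+ t. (\<integral>\<^sup>+ c. G c \<partial>lborel) * indicator {0..1::real} t \<partial>lborel)"
  proof -
    have "(\<integral>\<^sup>+ c. G (c + e) \<partial>lborel) = (\<integral>\<^sup>+ c. G c \<partial>lborel)" for e
      using nn_integral_distr[of "(+) e" lborel borel G] by (simp add: lborel_distr_plus add.commute)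
    then show ?thesis by (simp add: nn_integral_multc)
  qed
  also have "\<dots> = 2 * (\<integral>\<^sup>+ w. G w \<partial>lborel)"
    by (simp add: nn_integral_cmult)
  finally show ?thesis by (simp add: G_def)
qed

text \<open>For finite exponent \<open>r\<close> the area average is compared with the norm through
  |f| <= 1 + |f|^r on a ball of finite area. That inequality is not homogeneous, hence the
  normalisation to norm at most 1.\<close>

lemma fock_norm_le_1_imp_bounded:
  assumes p: "1 \<le> p"
  obtains B where "0 < B" "\<And>f z. f holomorphic_on UNIV \<Longrightarrow> fock_norm p f \<le> 1 \<Longrightarrow> norm z \<le> R \<Longrightarrow> norm (f z) \<le> B"
proof (cases "p = \<infinity>")
  case True
  show ?thesis
  proof (rule that[of "exp (R\<^sup>2 / 2)"])
    fix f :: "complex \<Rightarrow> complex" and z :: complex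
    assume "fock_norm p f \<le> 1" and z: "norm z \<le> R"
    then have "ennreal (norm (f z) * exp (- (1 / 2) * (norm z)\<^sup>2)) \<le> 1"
      using True unfolding fock_norm_def by (simp add: SUP_le_iff)
    then have "norm (f z) * exp (- (1 / 2) * (norm z)\<^sup>2) \<le> 1" by simp
    then have "norm (f z) \<le> exp ((norm z)\<^sup>2 / 2)" by (simp add: exp_minus field_simps)
    also have "\<dots> \<le> exp (R\<^sup>2 / 2)" using z by (simp add: power_mono)
    finally show "norm (f z) \<le> exp (R\<^sup>2 / 2)" .
  qed simp
next
  case False
  define r where "r = enn2real p"
  have r: "1 \<le> r" unfolding r_def using enn2real_ge_1[OF p False] .
  define E where "E = exp ((r / 2) * (R + 4)\<^sup>2)"
  define v where "v = unit_ball_vol 2"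
  have v: "0 < v" "emeasure lborel (ball z 1) = ennreal v" for z :: complex
    by (simp_all add: v_def emeasure_ball)
  \<comment> \<open>The area comes from the summand 1, \<open>E\<close> bounds the inverse of the
    weight on the ball, \<open>2 * pi / r\<close> inverts the normalising factor of the norm, and 2
    is the constant of the area average.\<close>
  define K where "K = 2 * (emeasure lborel (ball (0::complex) (R + 4)) + ennreal E * ennreal (2 * pi / r))"
  have K: "K < \<infinity>"
    unfolding K_def using emeasure_lborel_ball_finite[of "0::complex" "R + 4"]
    by (simp add: ennreal_mult_less_top infinity_ennreal_def)
  have bound: "ennreal (v * norm (f z)) \<le> K"
    if f: "f holomorphic_on UNIV" and 1: "fock_norm p f \<le> 1" and z: "norm z \<le> R" for f z
  proof -
    note [measurable] = borel_measurable_entire[OF f]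
    let ?h = "\<lambda>w. ennreal (norm (f w) powr r * exp (- (r / 2) * (norm w)\<^sup>2))"
    have "fock_integral r f \<le> 1"
      using 1 fock_norm_le_iff[OF False p, of 1 f] by (simp add: r_def)
    then have "ennreal (2 * pi / r) * fock_integral r f \<le> ennreal (2 * pi / r)"
      using mult_left_mono[of "fock_integral r f" 1 "ennreal (2 * pi / r)"] by simp
    then have h: "(\<integral>\<^sup>+ w. ?h w \<partial>lborel) \<le> ennreal (2 * pi / r)"
      unfolding fock_integral_def using r by (simp add: mult.assoc[symmetric] flip: ennreal_mult)
    have "ennreal (v * norm (f z)) \<le> 2 * (\<integral>\<^sup>+ w. ennreal (norm (f w)) * indicator (ball z 4) w \<partial>lborel)"
      using norm_entire_le_area_average[OF f, of z] v by (simp add: ennreal_mult)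
    also have "\<dots> \<le> 2 * (\<integral>\<^sup>+ w. (indicator (ball 0 (R + 4)) w + ennreal E * ?h w) \<partial>lborel)"
    proof (intro mult_left_mono nn_integral_mono)
      fix w
      show "ennreal (norm (f w)) * indicator (ball z 4) w \<le> indicator (ball 0 (R + 4)) w + ennreal E * ?h w"
      proof (cases "w \<in> ball z 4")
        case True
        then have w: "norm w < R + 4"
          using z norm_triangle_ineq[of "w - z" z] by (simp add: dist_norm norm_minus_commute)
        have "norm (f w) \<le> 1 + norm (f w) powr r"
        proof (cases "norm (f w) \<le> 1")
          case False
          then have "norm (f w) powr 1 \<le> norm (f w) powr r" using r by (intro powr_mono) auto
          then show ?thesis using False by simp
        qed (simp add: add_increasing2)
        also have "norm (f w) powr r = exp ((r / 2) * (norm w)\<^sup>2) * (norm (f w) powr r * exp (- (r / 2) * (norm w)\<^sup>2))"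
          by (simp add: mult_exp_exp)
        also have "\<dots> \<le> E * (norm (f w) powr r * exp (- (r / 2) * (norm w)\<^sup>2))"
          unfolding E_def using w r by (intro mult_right_mono) (auto intro!: power_mono mult_left_mono)
        finally have "ennreal (norm (f w)) \<le> ennreal (1 + E * (norm (f w) powr r * exp (- (r / 2) * (norm w)\<^sup>2)))"
          by (auto intro!: ennreal_leI)
        also have "\<dots> = 1 + ennreal E * ?h w"
          by (simp add: E_def ennreal_mult)
        finally show ?thesis using True w by (simp add: dist_norm)
      qed simp
    qed simp
    also have "\<dots> = 2 * (emeasure lborel (ball (0::complex) (R + 4)) + ennreal E * (\<integral>\<^sup>+ w. ?h w \<partial>lborel))"
      by (subst nn_integral_add) (auto simp: nn_integral_cmult intro!: borel_measurable_indicator)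
    also have "\<dots> \<le> K"
      unfolding K_def by (intro mult_left_mono add_left_mono h) auto
    finally show ?thesis .
  qed
  obtain k where k: "0 \<le> k" "K = ennreal k"
    using K by (cases K) (auto simp: infinity_ennreal_def)
  show ?thesis
  proof (rule that[of "k / v + 1"])
    show "0 < k / v + 1" using k v by (simp add: add_nonneg_pos)
    fix f :: "complex \<Rightarrow> complex" and z :: complex
    assume "f holomorphic_on UNIV" "fock_norm p f \<le> 1" "norm z \<le> R"
    then have "v * norm (f z) \<le> k" using bound[of f z] k by (simp add: ennreal_le_iff)
    then have "norm (f z) \<le> k / v" using v by (simp add: field_simps)
    then show "norm (f z) \<le> k / v + 1" by simp
  qed
qed

section \<open>Fock spaces as Banach spaces\<close>

text \<open>\<open>enn2real\<close> sends an infinite norm to 0, so the value is meaningful only on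
  \<open>fock_space p\<close>. For this reason \<open>fnormI\<close> yields membership together with
  the bound.\<close>

definition fnorm :: "ennreal \<Rightarrow> (complex \<Rightarrow> complex) \<Rightarrow> real" where
  "fnorm p f = enn2real (fock_norm p f)"

lemma fock_space_holomorphic: "f \<in> fock_space p \<Longrightarrow> f holomorphic_on UNIV"
  by (simp add: fock_space_def)

lemma fock_space_measurable: "f \<in> fock_space p \<Longrightarrow> f \<in> borel_measurable borel"
  by (rule borel_measurable_entire[OF fock_space_holomorphic])

lemma fnorm_nonneg [simp]: "0 \<le> fnorm p f"
  by (simp add: fnorm_def)

lemma ennreal_fnorm: "f \<in> fock_space p \<Longrightarrow> ennreal (fnorm p f) = fock_norm p f"
  by (auto simp: fnorm_def fock_space_def infinity_ennreal_def)

lemma fnormI: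
  assumes "f holomorphic_on UNIV" "fock_norm p f \<le> ennreal a" "0 \<le> a"
  shows "f \<in> fock_space p" "fnorm p f \<le> a"
proof -
  show f: "f \<in> fock_space p"
    using assms by (auto simp: fock_space_def infinity_ennreal_def intro: le_less_trans)
  show "fnorm p f \<le> a"
    using assms ennreal_fnorm[OF f] by (metis ennreal_le_iff)
qed

lemma fock_dist_eq_fnorm: "fock_dist p f g = fnorm p (\<lambda>z. f z - g z)"
  by (simp add: fock_dist_def fnorm_def)

lemma fock_space_add:
  assumes "1 \<le> p" "f \<in> fock_space p" "g \<in> fock_space p"
  shows "(\<lambda>z. f z + g z) \<in> fock_space p" "fnorm p (\<lambda>z. f z + g z) \<le> fnorm p f + fnorm p g"
proof -
  have "fock_norm p (\<lambda>z. f z + g z) \<le> ennreal (fnorm p f + fnorm p g)"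
    using fock_norm_triangle[OF assms(1) fock_space_measurable fock_space_measurable] assms
    by (simp add: ennreal_fnorm)
  moreover have "(\<lambda>z. f z + g z) holomorphic_on UNIV"
    using assms by (intro holomorphic_intros fock_space_holomorphic)
  moreover have "0 \<le> fnorm p f + fnorm p g" by simp
  ultimately show "(\<lambda>z. f z + g z) \<in> fock_space p" "fnorm p (\<lambda>z. f z + g z) \<le> fnorm p f + fnorm p g"
    using fnormI by blast+
qed

lemma fock_space_cmult:
  assumes "1 \<le> p" "f \<in> fock_space p"
  shows "(\<lambda>z. c * f z) \<in> fock_space p" "fnorm p (\<lambda>z. c * f z) = norm c * fnorm p f"
proof -
  have eq: "fock_norm p (\<lambda>z. c * f z) = ennreal (norm c * fnorm p f)"
    using fock_norm_cmult[OF assms(1) fock_space_measurable] assms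
    by (simp add: ennreal_fnorm ennreal_mult)
  have "(\<lambda>z. c * f z) holomorphic_on UNIV"
    using assms by (intro holomorphic_intros fock_space_holomorphic)
  then show "(\<lambda>z. c * f z) \<in> fock_space p"
    using eq by (intro fnormI[of _ _ "norm c * fnorm p f"]) auto
  show "fnorm p (\<lambda>z. c * f z) = norm c * fnorm p f"
    by (simp add: fnorm_def[of p "\<lambda>z. c * f z"] eq)
qed

lemma fnorm_diff_le:
  assumes "1 \<le> p" "f \<in> fock_space p" "g \<in> fock_space p"
  shows "fnorm p (\<lambda>z. f z - g z) \<le> fnorm p f + fnorm p g"
  using fock_space_add(2)[OF assms(1,2) fock_space_cmult(1)[OF assms(1,3), of "-1"]]
    fock_space_cmult(2)[OF assms(1,3), of "-1"] by simp

lemma fock_space_zero: "(\<lambda>z. 0) \<in> fock_space p" "fnorm p (\<lambda>z. 0) = 0"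
  by (auto simp: fock_space_def fnorm_def fock_norm_def fock_integral_def)

lemma fock_space_sum:
  assumes "1 \<le> p" "finite A" "\<And>i. i \<in> A \<Longrightarrow> f i \<in> fock_space p"
  shows "(\<lambda>z. \<Sum>i\<in>A. f i z) \<in> fock_space p"
    "fnorm p (\<lambda>z. \<Sum>i\<in>A. f i z) \<le> (\<Sum>i\<in>A. fnorm p (f i))"
proof -
  have "(\<lambda>z. \<Sum>i\<in>A. f i z) \<in> fock_space p \<and>
    fnorm p (\<lambda>z. \<Sum>i\<in>A. f i z) \<le> (\<Sum>i\<in>A. fnorm p (f i))"
    using assms(2,3)
  proof (induction A rule: finite_induct)
    case (insert x A)
    then have x: "f x \<in> fock_space p" and A: "(\<lambda>z. \<Sum>i\<in>A. f i z) \<in> fock_space p"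
      and le: "fnorm p (\<lambda>z. \<Sum>i\<in>A. f i z) \<le> (\<Sum>i\<in>A. fnorm p (f i))"
      by auto
    show ?case
      using fock_space_add[OF assms(1) x A] le insert.hyps by simp
  qed (simp add: fock_space_zero)
  then show "(\<lambda>z. \<Sum>i\<in>A. f i z) \<in> fock_space p"
    "fnorm p (\<lambda>z. \<Sum>i\<in>A. f i z) \<le> (\<Sum>i\<in>A. fnorm p (f i))" by auto
qed

text \<open>Scaling to norm 1 makes the previous bound homogeneous. A function of norm 0 cannot be
  scaled, but it vanishes identically.\<close>

lemma fock_point_evaluation_bound:
  assumes p: "1 \<le> p"
  obtains B where "0 < B" "\<And>f z. f \<in> fock_space p \<Longrightarrow> norm z \<le> R \<Longrightarrow> norm (f z) \<le> B * fnorm p f"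
proof -
  obtain B where B: "0 < B"
    "\<And>f z. f holomorphic_on UNIV \<Longrightarrow> fock_norm p f \<le> 1 \<Longrightarrow> norm z \<le> R \<Longrightarrow> norm (f z) \<le> B"
    using fock_norm_le_1_imp_bounded[OF p, of R] by metis
  show ?thesis
  proof (rule that[OF B(1)])
    fix f and z :: complex assume f: "f \<in> fock_space p" and z: "norm z \<le> R"
    show "norm (f z) \<le> B * fnorm p f"
    proof (cases "fnorm p f = 0")
      case True
      then have "fock_norm p f = 0" using ennreal_fnorm[OF f] by simp
      then show ?thesis
        using fock_norm_eq_0_imp[OF p holomorphic_on_imp_continuous_on[OF fock_space_holomorphic[OF f]]] True
        by simp
    next
      case False
      then have pos: "0 < fnorm p f" using fnorm_nonneg[of p f] by linarith
      let ?c = "of_real (1 / fnorm p f) :: complex"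
      have g: "(\<lambda>z. ?c * f z) \<in> fock_space p" "fnorm p (\<lambda>z. ?c * f z) = 1"
        using fock_space_cmult[OF p f, of ?c] pos by (auto simp: norm_divide)
      then have "fock_norm p (\<lambda>z. ?c * f z) \<le> 1" using ennreal_fnorm[OF g(1)] by simp
      from B(2)[OF fock_space_holomorphic[OF g(1)] this z]
      show ?thesis using pos by (simp add: norm_mult norm_divide field_simps)
    qed
  qed
qed

text \<open>Cauchy's inequality on the unit circle. It will control the polynomial part of a
  preimage, that is, its component along the kernel of the operator.\<close>

lemma fock_derivative_bound:
  assumes p: "1 \<le> p"
  obtains B where "0 < B" "\<And>f. f \<in> fock_space p \<Longrightarrow> norm ((deriv ^^ i) f 0) \<le> B * fnorm p f"
proof -
  obtain B where B: "0 < B"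
    "\<And>f z. f \<in> fock_space p \<Longrightarrow> norm z \<le> 1 \<Longrightarrow> norm (f z) \<le> B * fnorm p f"
    using fock_point_evaluation_bound[OF p] by blast
  show ?thesis
  proof (rule that[of "fact i * B"])
    fix f assume f: "f \<in> fock_space p"
    have "norm ((deriv ^^ i) f 0) \<le> fact i * (B * fnorm p f) / 1 ^ i"
    proof (rule Cauchy_inequality)
      show "f holomorphic_on ball 0 1" "continuous_on (cball 0 1) f"
        using fock_space_holomorphic[OF f]
        by (auto intro: holomorphic_on_imp_continuous_on holomorphic_on_subset)
    qed (use B(2)[OF f] in auto)
    then show "norm ((deriv ^^ i) f 0) \<le> fact i * B * fnorm p f" by simp
  qed (use B in simp)
qed

text \<open>Bounded point evaluations make a norm-bounded sequence locally bounded, so Montel's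
  theorem applies; locally uniform convergence passes to all derivatives. This compactness is
  available also for \<open>p = 1\<close> and \<open>p = \<infinity>\<close>, where the spaces are
  not reflexive.\<close>

lemma fock_Montel:
  fixes f :: "nat \<Rightarrow> complex \<Rightarrow> complex"
  assumes p: "1 \<le> p" and f: "\<And>k. f k \<in> fock_space p" and le: "\<And>k. fnorm p (f k) \<le> a"
  obtains g r where "strict_mono (r :: nat \<Rightarrow> nat)" "g \<in> fock_space p" "fnorm p g \<le> a"
    "\<And>n z. (\<lambda>k. (deriv ^^ n) (f (r k)) z) \<longlonglongrightarrow> (deriv ^^ n) g z"
proof -
  have a: "0 \<le> a" using le[of 0] fnorm_nonneg[of p "f 0"] by linarith
  obtain g r where g: "g holomorphic_on UNIV" and r: "strict_mono (r :: nat \<Rightarrow> nat)"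
    and pt: "\<And>x. (\<lambda>k. f (r k) x) \<longlonglongrightarrow> g x"
    and unif: "\<And>K. compact K \<Longrightarrow> uniform_limit K (f \<circ> r) g sequentially"
  proof (rule Montel[of UNIV "range f" f])
    fix K :: "complex set" assume "compact K"
    then obtain R where R: "\<And>z. z \<in> K \<Longrightarrow> norm z \<le> R"
      using compact_imp_bounded bounded_iff by metis
    obtain B where B: "0 < B" "\<And>f z. f \<in> fock_space p \<Longrightarrow> norm z \<le> R \<Longrightarrow> norm (f z) \<le> B * fnorm p f"
      using fock_point_evaluation_bound[OF p, of R] by metis
    have "norm (f k z) \<le> B * a" if "z \<in> K" for k z
      using B(2)[OF f[of k] R[OF that]] mult_left_mono[OF le[of k], of B] B(1) by linarith
    then show "\<exists>B. \<forall>h\<in>range f. \<forall>z\<in>K. norm (h z) \<le> B" by blast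
  qed (use fock_space_holomorphic[OF f] in auto)
  have "fock_norm p g \<le> ennreal a"
  proof (rule fock_norm_le_of_tendsto[OF p a _ _ pt])
    show "fock_norm p (f (r k)) \<le> ennreal a" for k
      using le[of "r k"] by (simp add: ennreal_leI flip: ennreal_fnorm[OF f])
  qed (use f fock_space_measurable in auto)
  note g' = fnormI[OF g this a]
  show ?thesis
  proof (rule that[OF r g'])
    fix n z
    show "(\<lambda>k. (deriv ^^ n) (f (r k)) z) \<longlonglongrightarrow> (deriv ^^ n) g z"
    proof (rule higher_deriv_complex_uniform_limit)
      show "uniform_limit (ball z 1) (\<lambda>k. f (r k)) g sequentially"
        using uniform_limit_on_subset[OF unif[of "cball z 1"] ball_subset_cball] by (simp add: o_def)
      show "\<forall>\<^sub>F k in sequentially. f (r k) holomorphic_on ball z 1"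
        by (intro always_eventually allI holomorphic_on_subset[OF fock_space_holomorphic[OF f]]) simp
    qed simp_all
  qed
qed

text \<open>A tail of a Cauchy sequence is bounded, and Montel's theorem supplies a pointwise limit
  of a subsequence as candidate. The Cauchy estimate for \<open>f n - f m\<close> then passes to the
  limit in \<open>m\<close> by lower semicontinuity of the norm.\<close>

lemma fock_mcomplete:
  assumes p: "1 \<le> p"
  shows "Metric_space.mcomplete (fock_space p) (fock_dist p)"
proof -
  interpret Metric_space "fock_space p" "fock_dist p"
    by (rule Metric_space_fock[OF p])
  show ?thesis
    unfolding mcomplete_def
  proof (intro allI impI)
    fix f assume C: "MCauchy f"
    then have f: "f k \<in> fock_space p" for k by (auto simp: MCauchy_def)
    have C': "\<exists>N. \<forall>n\<ge>N. \<forall>n'\<ge>N. fnorm p (\<lambda>z. f n z - f n' z) < e" if "0 < e" for e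
      using C that unfolding MCauchy_def fock_dist_eq_fnorm by meson
    from C'[of 1] obtain N where N: "\<And>n. N \<le> n \<Longrightarrow> fnorm p (\<lambda>z. f n z - f N z) < 1"
      by (metis order_refl zero_less_one)
    have bd: "fnorm p (f (N + k)) \<le> 1 + fnorm p (f N)" for k
      using fock_space_add(2)[OF p fock_space_diff[OF p f f] f, of "N + k" N N] N[of "N + k"] by simp
    obtain g r where r: "strict_mono (r :: nat \<Rightarrow> nat)" and g: "g \<in> fock_space p"
      and lim: "\<And>n z. (\<lambda>k. (deriv ^^ n) (f (N + r k)) z) \<longlonglongrightarrow> (deriv ^^ n) g z"
      using fock_Montel[OF p, of "\<lambda>k. f (N + k)", OF f bd] by metis
    have "limitin mtopology f g sequentially"
      unfolding limit_metric_sequentially fock_dist_eq_fnorm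
    proof (intro conjI allI impI g)
      fix e :: real assume e: "0 < e"
      obtain M where M: "\<And>n n'. M \<le> n \<Longrightarrow> M \<le> n' \<Longrightarrow> fnorm p (\<lambda>z. f n z - f n' z) < e / 2"
        using C'[of "e / 2"] e by (metis half_gt_zero)
      have "fnorm p (\<lambda>z. f n z - g z) < e" if n: "M \<le> n" for n
      proof -
        have "fock_norm p (\<lambda>z. f n z - g z) \<le> ennreal (e / 2)"
        proof (rule fock_norm_le_of_tendsto[OF p])
          \<comment> \<open>The shift by \<open>M\<close> puts every index beyond \<open>M\<close>,
            so that the Cauchy estimate holds for all \<open>k\<close> and not just
            eventually.\<close>
          show "(\<lambda>k. f n z - f (N + r (M + k)) z) \<longlonglongrightarrow> f n z - g z" for z
            using LIMSEQ_ignore_initial_segment[OF lim[of 0 z], of M]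
            by (intro tendsto_intros) (simp add: add.commute)
          show "fock_norm p (\<lambda>z. f n z - f (N + r (M + k)) z) \<le> ennreal (e / 2)" for k
          proof -
            have "M \<le> N + r (M + k)" using seq_suble[OF r, of "M + k"] by linarith
            then show ?thesis
              using M[OF n] fock_space_diff[OF p f f] by (simp add: ennreal_leI less_imp_le flip: ennreal_fnorm)
          qed
        qed (use e fock_space_measurable[OF fock_space_diff[OF p f f]] in auto)
        then have "fnorm p (\<lambda>z. f n z - g z) \<le> e / 2"
          using e fock_space_diff[OF p f g] by (intro fnormI(2) fock_space_holomorphic) auto
        then show ?thesis using e by simp
      qed
      then show "\<exists>N. \<forall>n\<ge>N. f n \<in> fock_space p \<and> fnorm p (\<lambda>z. f n z - g z) < e"
        using f by blast
    qed
    then show "\<exists>g. limitin mtopology f g sequentially" by blast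
  qed
qed

section \<open>Bounded operators with closed range\<close>

lemma weighted_comp_diff_diff:
  assumes "f holomorphic_on UNIV" "g holomorphic_on UNIV"
  shows "weighted_comp_diff u \<psi> n (\<lambda>z. f z - g z) =
    (\<lambda>z. weighted_comp_diff u \<psi> n f z - weighted_comp_diff u \<psi> n g z)"
  using higher_deriv_diff[OF assms open_UNIV UNIV_I, of n]
  by (simp add: weighted_comp_diff_def right_diff_distrib)

lemma weighted_comp_diff_add:
  assumes "f holomorphic_on UNIV" "g holomorphic_on UNIV"
  shows "weighted_comp_diff u \<psi> n (\<lambda>z. f z + g z) =
    (\<lambda>z. weighted_comp_diff u \<psi> n f z + weighted_comp_diff u \<psi> n g z)"
  using higher_deriv_add[OF assms, of _ n] by (auto simp: weighted_comp_diff_def algebra_simps)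

lemma weighted_comp_diff_cmult:
  assumes "f holomorphic_on UNIV"
  shows "weighted_comp_diff u \<psi> n (\<lambda>z. c * f z) = (\<lambda>z. c * weighted_comp_diff u \<psi> n f z)"
  using higher_deriv_cmult[OF assms, of _ n c] by (auto simp: weighted_comp_diff_def algebra_simps)

lemma weighted_comp_diff_zero: "weighted_comp_diff u \<psi> n (\<lambda>z. 0) = (\<lambda>z. 0)"
  using weighted_comp_diff_cmult[of "\<lambda>z. 0" u \<psi> n 0] by simp

text \<open>The identity theorem, twice: the derivative composed with \<psi> vanishes on the
  nonempty open set where \<open>u\<close> does not, hence everywhere; so the derivative vanishes on
  the range of \<psi>, which is open by the open mapping theorem.\<close>

lemma weighted_comp_diff_eq_0_imp:
  assumes u: "u holomorphic_on UNIV" "\<exists>z. u z \<noteq> 0"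
    and \<psi>: "\<psi> holomorphic_on UNIV" "\<not> \<psi> constant_on UNIV"
    and h: "h holomorphic_on UNIV" and 0: "\<And>z. weighted_comp_diff u \<psi> n h z = 0"
  shows "(deriv ^^ n) h w = 0"
proof -
  define H where "H = (deriv ^^ n) h"
  have H: "H holomorphic_on UNIV"
    unfolding H_def by (rule holomorphic_higher_deriv[OF h open_UNIV])
  have H\<psi>: "(\<lambda>z. H (\<psi> z)) holomorphic_on UNIV"
    using holomorphic_on_compose[OF \<psi>(1) holomorphic_on_subset[OF H]] by (simp add: o_def)
  have "open {z. u z \<noteq> 0}"
    by (intro open_Collect_neq holomorphic_on_imp_continuous_on u continuous_on_const)
  moreover have "{z. u z \<noteq> 0} \<noteq> {}" using u by auto
  moreover have "H (\<psi> z) = 0" if "z \<in> {z. u z \<noteq> 0}" for z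
    using 0[of z] that by (simp add: weighted_comp_diff_def H_def)
  ultimately have "H (\<psi> z) = 0" for z
    using analytic_continuation_open[of "{z. u z \<noteq> 0}" UNIV "\<lambda>z. H (\<psi> z)" "\<lambda>z. 0" z] H\<psi> connected_UNIV by auto
  moreover have "open (range \<psi>)"
    using open_mapping_thm[OF \<psi>(1) open_UNIV connected_UNIV open_UNIV subset_refl \<psi>(2)] .
  ultimately show ?thesis
    using analytic_continuation_open[of "range \<psi>" UNIV H "\<lambda>z. 0" w] H connected_UNIV by (auto simp: H_def)
qed

lemma entire_eq_Taylor_polynomial:
  assumes h: "h holomorphic_on UNIV" and 0: "\<And>w. (deriv ^^ n) h w = 0"
  shows "h z = (\<Sum>i<n. (deriv ^^ i) h 0 / fact i * z ^ i)"
proof -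
  have z: "z \<in> ball 0 (norm z + 1)" by simp
  have "(\<lambda>i. (deriv ^^ i) h 0 / fact i * (z - 0) ^ i) sums h z"
    by (rule holomorphic_power_series[OF holomorphic_on_subset[OF h] z]) simp
  moreover have "(deriv ^^ i) h 0 = 0" if "n \<le> i" for i
  proof -
    have "(deriv ^^ i) h = (deriv ^^ (i - n)) ((deriv ^^ n) h)"
      using that by (metis comp_apply funpow_add le_add_diff_inverse2)
    also have "(deriv ^^ n) h = (\<lambda>w. 0)" using 0 by auto
    finally show ?thesis by simp
  qed
  then have "(\<lambda>i. (deriv ^^ i) h 0 / fact i * (z - 0) ^ i) sums (\<Sum>i<n. (deriv ^^ i) h 0 / fact i * (z - 0) ^ i)"
    by (intro sums_finite) (auto simp: not_less)
  ultimately have "h z = (\<Sum>i<n. (deriv ^^ i) h 0 / fact i * (z - 0) ^ i)"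
    by (rule sums_unique2)
  then show ?thesis by simp
qed

text \<open>The open mapping theorem. By Montel's theorem the image of a ball of \<open>\<F>\<^sub>p\<close> is already closed, so Baire's
  theorem yields an image of a ball with interior points and no successive approximation is needed.\<close>

lemma closed_range_imp_bounded_preimage:
  assumes p: "1 \<le> p" and q: "1 \<le> q"
    and bdd: "fock_bounded p q (weighted_comp_diff u \<psi> n)"
    and clo: "fock_closed_range p q (weighted_comp_diff u \<psi> n)"
  obtains M where "0 \<le> M" "\<And>f. f \<in> fock_space p \<Longrightarrow> \<exists>g\<in>fock_space p.
    weighted_comp_diff u \<psi> n g = weighted_comp_diff u \<psi> n f \<and>
    fnorm p g \<le> M * fnorm q (weighted_comp_diff u \<psi> n f)"
proof -
  define T where "T = weighted_comp_diff u \<psi> n"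
  define R where "R = T ` fock_space p"
  define A where "A m = T ` {f \<in> fock_space p. fnorm p f \<le> real m}" for m
  have R: "R \<subseteq> fock_space q"
    using bdd by (simp add: R_def T_def fock_bounded_def)
  interpret Q: Metric_space "fock_space q" "fock_dist q"
    by (rule Metric_space_fock[OF q])
  interpret S: Submetric "fock_space q" "fock_dist q" R
    by unfold_locales (rule R)
  have "closedin Q.mtopology R"
    using clo by (simp add: fock_closed_range_def R_def T_def)
  then have complete: "S.sub.mcomplete"
    by (rule S.closedin_mcomplete_imp_mcomplete) (rule fock_mcomplete[OF q])
  have closed_A: "closedin S.sub.mtopology (A m)" for m
    unfolding S.sub.metric_closedin_iff_sequentially_closed
  proof (intro conjI allI impI)
    show "A m \<subseteq> R" by (auto simp: A_def R_def)
    fix \<sigma> h assume "range \<sigma> \<subseteq> A m \<and> limitin S.sub.mtopology \<sigma> h sequentially"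
    then have \<sigma>: "\<sigma> k \<in> A m" and lim: "limitin S.sub.mtopology \<sigma> h sequentially" for k by auto
    have "\<exists>f. f \<in> fock_space p \<and> fnorm p f \<le> real m \<and> \<sigma> k = T f" for k
      using \<sigma>[of k] by (auto simp: A_def)
    then obtain f where f: "\<And>k. f k \<in> fock_space p" "\<And>k. fnorm p (f k) \<le> real m" "\<And>k. \<sigma> k = T (f k)"
      by metis
    obtain g r where r: "strict_mono (r :: nat \<Rightarrow> nat)" and g: "g \<in> fock_space p" "fnorm p g \<le> real m"
      and g': "\<And>n z. (\<lambda>k. (deriv ^^ n) (f (r k)) z) \<longlonglongrightarrow> (deriv ^^ n) g z"
      using fock_Montel[OF p, of f, OF f(1,2)] by metis
    have h: "h \<in> R" and lim': "\<And>e. 0 < e \<Longrightarrow> \<exists>N. \<forall>k\<ge>N. fock_dist q (\<sigma> k) h < e"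
      using lim unfolding S.sub.limit_metric_sequentially by blast+
    \<comment> \<open>Both sides are pointwise limits of the same subsequence: the left one because
      point evaluations are continuous in the norm, the right one because the derivatives of the
      preimages converge.\<close>
    have "h z = T g z" for z
    proof -
      obtain B where B: "0 < B" "\<And>f. f \<in> fock_space q \<Longrightarrow> norm (f z) \<le> B * fnorm q f"
        using fock_point_evaluation_bound[OF q, of "norm z"] by (metis order_refl)
      have d: "norm (\<sigma> k z - h z) \<le> B * fock_dist q (\<sigma> k) h" for k
        unfolding fock_dist_eq_fnorm using \<sigma>[of k] h R
        by (intro B(2) fock_space_diff[OF q]) (auto simp: A_def R_def)
      have "(\<lambda>k. \<sigma> k z) \<longlonglongrightarrow> h z"
      proof (rule LIMSEQ_I)
        fix e :: real assume e: "0 < e"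
        then obtain N where N: "\<forall>k\<ge>N. fock_dist q (\<sigma> k) h < e / B"
          using lim'[of "e / B"] B(1) by auto
        have "norm (\<sigma> k z - h z) < e" if "N \<le> k" for k
        proof -
          have "B * fock_dist q (\<sigma> k) h < e" using N that B(1) by (simp add: field_simps)
          then show ?thesis using d[of k] by linarith
        qed
        then show "\<exists>N. \<forall>k\<ge>N. norm (\<sigma> k z - h z) < e" by blast
      qed
      then have "(\<lambda>k. \<sigma> (r k) z) \<longlonglongrightarrow> h z"
        using LIMSEQ_subseq_LIMSEQ[OF _ r] by (simp add: o_def)
      moreover have "(\<lambda>k. \<sigma> (r k) z) \<longlonglongrightarrow> T g z"
        unfolding f(3) T_def weighted_comp_diff_def by (intro tendsto_intros g')
      ultimately show ?thesis by (rule LIMSEQ_unique)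
    qed
    then show "h \<in> A m" using g by (auto simp: A_def fun_eq_iff)
  qed
  have UA: "\<Union> (range A) = R"
    unfolding A_def R_def using real_arch_simple by blast
  have "(\<lambda>z. 0) \<in> R"
    unfolding R_def T_def using fock_space_zero(1) weighted_comp_diff_zero by (metis imageI)
  have "\<exists>m. S.sub.mtopology interior_of (A m) \<noteq> {}"
  proof (rule ccontr)
    assume "\<nexists>m. S.sub.mtopology interior_of (A m) \<noteq> {}"
    then have "S.sub.mtopology interior_of \<Union> (range A) = {}"
      using closed_A by (intro S.sub.metric_Baire_category_alt[OF complete]) auto
    then show False
      using UA \<open>(\<lambda>z. 0) \<in> R\<close> interior_of_topspace[of S.sub.mtopology] by auto
  qed
  then obtain m h0 where h0: "h0 \<in> S.sub.mtopology interior_of (A m)" by blast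
  then obtain e where e: "0 < e" "S.sub.mball h0 e \<subseteq> A m"
    using openin_interior_of[of S.sub.mtopology "A m"] interior_of_subset[of S.sub.mtopology "A m"]
    unfolding S.sub.openin_mtopology by (meson order_trans)
  have "h0 \<in> A m" by (rule subsetD[OF interior_of_subset h0])
  then obtain f0 where f0: "f0 \<in> fock_space p" "fnorm p f0 \<le> real m" "h0 = T f0"
    by (auto simp: A_def)
  show ?thesis
  \<comment> \<open>Two functions of norm at most \<open>m\<close> differ by at most
    \<open>2 * m\<close> in norm; undoing the scaling by \<open>s\<close> below contributes the
    factor \<open>2 / e\<close> times the norm of \<open>T f\<close>.\<close>
  proof (rule that[of "4 * real m / e"], use e in simp)
    fix f assume f: "f \<in> fock_space p"
    have Tf: "T f \<in> fock_space q" "T f0 \<in> fock_space q" using f f0 R by (auto simp: R_def)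
    have "\<exists>g\<in>fock_space p. T g = T f \<and> fnorm p g \<le> 4 * real m / e * fnorm q (T f)"
    proof (cases "fnorm q (T f) = 0")
      case True
      then have "fock_norm q (T f) = 0" using ennreal_fnorm[OF Tf(1)] by simp
      then have "T f = (\<lambda>z. 0)"
        using fock_norm_eq_0_imp[OF q holomorphic_on_imp_continuous_on[OF fock_space_holomorphic[OF Tf(1)]]]
        by auto
      then show ?thesis
        using True fock_space_zero weighted_comp_diff_zero[of u \<psi> n]
        by (intro bexI[of _ "\<lambda>z. 0"]) (auto simp: T_def)
    next
      case False
      then have pos: "0 < fnorm q (T f)" using fnorm_nonneg[of q "T f"] by linarith
      \<comment> \<open>With this scale \<open>s * T f\<close> has norm \<open>e / 2\<close>, so
        adding it to \<open>h0\<close> does not leave the ball.\<close>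
      define s where "s = e / (2 * fnorm q (T f))"
      have s: "0 < s" using e pos by (simp add: s_def)
      define F where "F = (\<lambda>z. f0 z + of_real s * f z)"
      have F: "F \<in> fock_space p"
        unfolding F_def by (intro fock_space_add fock_space_cmult p f f0)
      have TF: "T F = (\<lambda>z. T f0 z + of_real s * T f z)"
        unfolding F_def T_def using f f0
        by (simp add: weighted_comp_diff_add weighted_comp_diff_cmult fock_space_holomorphic holomorphic_intros)
      have "fock_dist q (T F) h0 = fnorm q (\<lambda>z. of_real s * T f z)"
        by (simp add: fock_dist_eq_fnorm TF f0)
      also have "\<dots> = s * fnorm q (T f)"
        using fock_space_cmult(2)[OF q Tf(1), of "of_real s"] s by simp
      also have "\<dots> < e" using e pos by (simp add: s_def)
      finally have "T F \<in> S.sub.mball h0 e"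
        unfolding S.sub.in_mball using F f0 by (simp add: R_def Q.commute)
      then obtain F' where F': "F' \<in> fock_space p" "fnorm p F' \<le> real m" "T F = T F'"
        using e by (auto simp: A_def)
      \<comment> \<open>\<open>F'\<close> has the same image as \<open>F\<close>, but unlike
        \<open>F\<close> a norm bound independent of \<open>f\<close>.\<close>
      define g where "g = (\<lambda>z. of_real (1 / s) * (F' z - f0 z))"
      have g: "g \<in> fock_space p"
        unfolding g_def by (intro fock_space_diff fock_space_cmult p F' f0)
      have "T g = (\<lambda>z. of_real (1 / s) * (T F' z - T f0 z))"
        unfolding g_def T_def using F' f0
        by (simp add: weighted_comp_diff_diff weighted_comp_diff_cmult fock_space_holomorphic holomorphic_intros
            del: of_real_divide of_real_1)
      also have "\<dots> = T f" using s unfolding F'(3)[symmetric] TF by auto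
      finally have Tg: "T g = T f" .
      have "fnorm p g = 1 / s * fnorm p (\<lambda>z. F' z - f0 z)"
        unfolding g_def using fock_space_cmult(2)[OF p fock_space_diff[OF p F'(1) f0(1)], of "of_real (1 / s)"] s
        by (simp add: norm_divide)
      also have "\<dots> \<le> 1 / s * (2 * real m)"
        using fnorm_diff_le[OF p F'(1) f0(1)] F'(2) f0(2) s by (intro mult_left_mono) auto
      also have "\<dots> = 4 * real m / e * fnorm q (T f)" by (simp add: s_def)
      finally show ?thesis using g Tg by blast
    qed
    then show "\<exists>g\<in>fock_space p. weighted_comp_diff u \<psi> n g = weighted_comp_diff u \<psi> n f \<and>
      fnorm p g \<le> 4 * real m / e * fnorm q (weighted_comp_diff u \<psi> n f)"
      by (simp add: T_def)
  qed
qed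

text \<open>A bounded preimage \<open>g\<close> of \<open>T f\<close> differs from \<open>f\<close>
  by a polynomial of degree below \<open>n\<close>. Its coefficients are those of \<open>f\<close>,
  which stay as an error term, minus those of \<open>g\<close>, which are bounded by the norm of
  \<open>g\<close> and thus by that of \<open>T f\<close>. For \<open>n = 0\<close> the error term
  is empty.\<close>

lemma closed_range_imp_norm_bound:
  assumes u: "u holomorphic_on UNIV" "\<exists>z. u z \<noteq> 0"
    and \<psi>: "\<psi> holomorphic_on UNIV" "\<not> \<psi> constant_on UNIV"
    and p: "1 \<le> p" and q: "1 \<le> q"
    and bdd: "fock_bounded p q (weighted_comp_diff u \<psi> n)"
    and clo: "fock_closed_range p q (weighted_comp_diff u \<psi> n)"
  obtains D where "0 < D" "\<And>f. f \<in> fock_space p \<Longrightarrow>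
    fnorm p f \<le> D * (fnorm q (weighted_comp_diff u \<psi> n f) + (\<Sum>i<n. norm ((deriv ^^ i) f 0)))"
proof -
  define T where "T = weighted_comp_diff u \<psi> n"
  obtain M where M: "0 \<le> M"
    "\<And>f. f \<in> fock_space p \<Longrightarrow> \<exists>g\<in>fock_space p. T g = T f \<and> fnorm p g \<le> M * fnorm q (T f)"
    using closed_range_imp_bounded_preimage[OF p q bdd clo] unfolding T_def by metis
  have "\<forall>i. \<exists>B>0. \<forall>f\<in>fock_space p. norm ((deriv ^^ i) f 0) \<le> B * fnorm p f"
    using fock_derivative_bound[OF p] by metis
  then obtain B where B: "\<And>i. 0 < B i"
    "\<And>i f. f \<in> fock_space p \<Longrightarrow> norm ((deriv ^^ i) f 0) \<le> B i * fnorm p f" by metis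
  define c where "c i = fnorm p (\<lambda>z. z ^ i)" for i
  define C where "C = (\<Sum>i<n. c i)"
  \<comment> \<open>The cost of the Taylor coefficients of \<open>g\<close>: the i-th derivative at
    0 is at most \<open>B i\<close> times the norm of \<open>g\<close>, and it multiplies a monomial
    of norm \<open>c i\<close>.\<close>
  define E where "E = (\<Sum>i<n. B i * c i)"
  have c: "0 \<le> c i" for i by (simp add: c_def)
  have cC: "c i \<le> C" if "i < n" for i
    unfolding C_def using that c by (intro member_le_sum) auto
  have nonneg: "0 \<le> C" "0 \<le> E"
    unfolding C_def E_def using c B(1) by (simp_all add: sum_nonneg less_imp_le)
  have main: "fnorm p f \<le> (M + M * E) * fnorm q (T f) + C * (\<Sum>i<n. norm ((deriv ^^ i) f 0))"
    if f: "f \<in> fock_space p" for f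
  proof -
    obtain g where g: "g \<in> fock_space p" "T g = T f" "fnorm p g \<le> M * fnorm q (T f)"
      using M(2)[OF f] by blast
    define h where "h = (\<lambda>z. f z - g z)"
    have h: "h \<in> fock_space p" unfolding h_def by (rule fock_space_diff[OF p f g(1)])
    have "T h z = T f z - T g z" for z
      unfolding h_def T_def
      using weighted_comp_diff_diff[OF fock_space_holomorphic[OF f] fock_space_holomorphic[OF g(1)]] by simp
    then have "T h z = 0" for z using g(2) by simp
    then have "(deriv ^^ n) h w = 0" for w
      using weighted_comp_diff_eq_0_imp[OF u \<psi> fock_space_holomorphic[OF h]] by (simp add: T_def)
    then have heq: "h = (\<lambda>z. \<Sum>i<n. (deriv ^^ i) h 0 / fact i * z ^ i)"
      using entire_eq_Taylor_polynomial[OF fock_space_holomorphic[OF h]] by auto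
    have hi: "norm ((deriv ^^ i) h 0) \<le> norm ((deriv ^^ i) f 0) + B i * fnorm p g" for i
    proof -
      have "(deriv ^^ i) h 0 = (deriv ^^ i) f 0 - (deriv ^^ i) g 0"
        unfolding h_def using f g by (intro higher_deriv_diff[of _ UNIV] fock_space_holomorphic) auto
      then show ?thesis
        using norm_triangle_ineq4[of "(deriv ^^ i) f 0" "(deriv ^^ i) g 0"] B(2)[OF g(1), of i] by simp
    qed
    have "fnorm p h \<le> (\<Sum>i<n. fnorm p (\<lambda>z. (deriv ^^ i) h 0 / fact i * z ^ i))"
      by (subst heq, intro fock_space_sum(2) fock_space_cmult(1) monomial_in_fock_space p) auto
    also have "\<dots> = (\<Sum>i<n. norm ((deriv ^^ i) h 0) / fact i * c i)"
      by (simp only: fock_space_cmult(2)[OF p monomial_in_fock_space[OF p]] c_def norm_divide norm_fact)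
    also have "\<dots> \<le> (\<Sum>i<n. C * norm ((deriv ^^ i) f 0) + B i * c i * fnorm p g)"
    proof (intro sum_mono)
      fix i assume i: "i \<in> {..<n}"
      have "norm ((deriv ^^ i) h 0) / fact i \<le> norm ((deriv ^^ i) h 0)"
        using fact_ge_1[of i, where 'a = real] by (simp add: divide_le_eq mult_le_cancel_left1)
      then have "norm ((deriv ^^ i) h 0) / fact i * c i \<le> (norm ((deriv ^^ i) f 0) + B i * fnorm p g) * c i"
        using hi[of i] c by (intro mult_right_mono) auto
      also have "\<dots> \<le> C * norm ((deriv ^^ i) f 0) + B i * c i * fnorm p g"
        using mult_left_mono[OF cC[of i], of "norm ((deriv ^^ i) f 0)"] i by (simp add: algebra_simps)
      finally show "norm ((deriv ^^ i) h 0) / fact i * c i \<le> C * norm ((deriv ^^ i) f 0) + B i * c i * fnorm p g" .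
    qed
    also have "\<dots> = C * (\<Sum>i<n. norm ((deriv ^^ i) f 0)) + E * fnorm p g"
      by (simp add: sum.distrib E_def sum_distrib_left sum_distrib_right)
    finally have "fnorm p h \<le> C * (\<Sum>i<n. norm ((deriv ^^ i) f 0)) + E * fnorm p g" .
    moreover have "fnorm p f \<le> fnorm p g + fnorm p h"
      using fock_space_add(2)[OF p g(1) h] by (simp add: h_def)
    moreover have "(1 + E) * fnorm p g \<le> (1 + E) * (M * fnorm q (T f))"
      using nonneg g(3) by (intro mult_left_mono) auto
    ultimately show ?thesis by (simp add: algebra_simps)
  qed
  \<comment> \<open>The summand 1 keeps \<open>D\<close> positive, as it will be divided by.\<close>
  define D where "D = M + M * E + C + 1"
  show ?thesis
  proof (rule that[of D])
    show "0 < D" using M nonneg by (auto simp: D_def intro!: add_nonneg_pos add_nonneg_nonneg)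
    fix f assume f: "f \<in> fock_space p"
    have "(M + M * E) * fnorm q (T f) \<le> D * fnorm q (T f)"
      "C * (\<Sum>i<n. norm ((deriv ^^ i) f 0)) \<le> D * (\<Sum>i<n. norm ((deriv ^^ i) f 0))"
      using M nonneg by (auto simp: D_def intro!: mult_right_mono sum_nonneg)
    with main[OF f]
    show "fnorm p f \<le> D * (fnorm q (weighted_comp_diff u \<psi> n f) + (\<Sum>i<n. norm ((deriv ^^ i) f 0)))"
      by (simp add: T_def distrib_left)
  qed
qed

section \<open>Test functions and signed sums\<close>

text \<open>The ratio \<open>a (k + 1) / a k\<close> at least halves with each step. It starts at 1
  or below because \<open>a 0\<close> is maximal, so the k-th ratio is at most 2^-k. The constant is
  1 for the first term plus 2 for the geometric series.\<close>

lemma sum_le_of_strongly_log_concave_decreasing: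
  fixes a :: "nat \<Rightarrow> real"
  assumes pos: "\<And>k. k < m \<Longrightarrow> 0 < a k"
    and conc: "\<And>k. k + 2 < m \<Longrightarrow> a (k + 2) * a k \<le> (a (k + 1))\<^sup>2 / 2"
    and le: "\<And>k. k < m \<Longrightarrow> a k \<le> a 0" and m: "0 < m"
  shows "(\<Sum>k<m. a k) \<le> 3 * a 0"
proof -
  have step: "k + 1 < m \<Longrightarrow> a (k + 1) \<le> (1 / 2) ^ k * a k" for k
  proof (induction k)
    case 0
    then show ?case using le[of 1] by simp
  next
    case (Suc k)
    have p: "0 < a k" "0 < a (k + 1)" using Suc pos by auto
    have "a (k + 2) * a k \<le> (a (k + 1))\<^sup>2 / 2" using conc Suc by simp
    also have "\<dots> = a (k + 1) * (1 / 2) * a (k + 1)" by (simp add: power2_eq_square)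
    also have "\<dots> \<le> a (k + 1) * (1 / 2) * ((1 / 2) ^ k * a k)"
      using Suc p by (intro mult_left_mono) auto
    finally have "a (k + 2) * a k \<le> ((1 / 2) ^ Suc k * a (k + 1)) * a k" by (simp add: mult_ac)
    then show ?case using p by simp
  qed
  obtain m' where m': "m = Suc m'" using m by (cases m) auto
  have "(\<Sum>k<m'. a (Suc k)) \<le> (\<Sum>k<m'. (1 / 2) ^ k * a 0)"
  proof (intro sum_mono)
    fix k assume "k \<in> {..<m'}"
    then have k: "k + 1 < m" "k < m" using m' by auto
    have "a (k + 1) \<le> (1 / 2) ^ k * a k" by (rule step[OF k(1)])
    also have "\<dots> \<le> (1 / 2) ^ k * a 0" by (intro mult_left_mono le k) simp
    finally show "a (Suc k) \<le> (1 / 2) ^ k * a 0" by simp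
  qed
  also have "\<dots> = (\<Sum>k<m'. (1 / 2) ^ k) * a 0" by (simp add: sum_distrib_right)
  also have "\<dots> \<le> 2 * a 0"
  proof (intro mult_right_mono)
    show "(\<Sum>k<m'. (1 / 2 :: real) ^ k) \<le> 2" by (simp add: sum_gp_strict)
  qed (use pos[OF m] in simp)
  finally show ?thesis unfolding m' sum.lessThan_Suc_shift by simp
qed

text \<open>Cut at a maximal term. The condition is invariant under reversal, so both halves, read
  outwards from the maximum, fall under the previous bound, and 6 = 3 + 3.\<close>

lemma sum_le_max_of_strongly_log_concave:
  fixes a :: "nat \<Rightarrow> real"
  assumes pos: "\<And>k. 0 < a k" and conc: "\<And>k. a (k + 2) * a k \<le> (a (k + 1))\<^sup>2 / 2" and N: "0 < N"
  obtains i where "i < N" "(\<Sum>j<N. a j) \<le> 6 * a i"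
proof -
  have "Max (a ` {..<N}) \<in> a ` {..<N}" using N by (intro Max_in) auto
  then obtain i where i: "i < N" "a i = Max (a ` {..<N})" by auto
  have max: "a j \<le> a i" if "j < N" for j
    unfolding i(2) using that by (intro Max_ge) auto
  have "(\<Sum>k<Suc i. a (i - k)) \<le> 3 * a (i - 0)"
  proof (rule sum_le_of_strongly_log_concave_decreasing)
    fix k assume k: "k + 2 < Suc i"
    then have "i - k = (i - (k + 2)) + 2" "i - (k + 1) = (i - (k + 2)) + 1" by auto
    then show "a (i - (k + 2)) * a (i - k) \<le> (a (i - (k + 1)))\<^sup>2 / 2"
      using conc[of "i - (k + 2)"] by (simp add: mult.commute)
  qed (use pos max i in auto)
  then have 1: "(\<Sum>j<Suc i. a j) \<le> 3 * a i"
    using sum.nat_diff_reindex[of a "Suc i"] by simp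
  have "(\<Sum>k<N - i. a (k + i)) \<le> 3 * a (0 + i)"
  proof (rule sum_le_of_strongly_log_concave_decreasing)
    fix k assume "k + 2 < N - i"
    show "a (k + 2 + i) * a (k + i) \<le> (a (k + 1 + i))\<^sup>2 / 2"
      using conc[of "k + i"] by (simp add: add_ac)
  qed (use pos max i in auto)
  then have 2: "(\<Sum>j\<in>{i..<N}. a j) \<le> 3 * a i"
    using sum.shift_bounds_nat_ivl[of a 0 i "N - i"] i by (simp add: atLeast0LessThan)
  have "(\<Sum>j<N. a j) = (\<Sum>j<i. a j) + (\<Sum>j\<in>{i..<N}. a j)"
    using sum.atLeastLessThan_concat[of 0 i N a] i by (simp add: atLeast0LessThan)
  then show ?thesis using 1 2 i pos[of i] by (intro that[of i]) auto
qed

text \<open>The normalised reproducing kernel at \<open>w\<close>: its modulus times the Gaussian weight is a translate of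
  the Gaussian weight.\<close>

definition test_fun :: "real \<Rightarrow> complex \<Rightarrow> complex" where
  "test_fun w z = exp (of_real w * z - of_real (w\<^sup>2 / 2))"

lemma test_fun_holomorphic: "test_fun w holomorphic_on UNIV"
  unfolding test_fun_def[abs_def] by (intro holomorphic_intros)

lemma higher_deriv_test_fun: "(deriv ^^ n) (test_fun w) = (\<lambda>z. of_real w ^ n * test_fun w z)"
proof (induction n)
  case (Suc n)
  have "deriv (\<lambda>z. of_real w ^ n * test_fun w z) z = of_real w ^ Suc n * test_fun w z" for z
    unfolding test_fun_def by (rule DERIV_imp_deriv) (auto intro!: derivative_eq_intros)
  with Suc show ?case by auto
qed simp

lemma norm_test_fun: "norm (test_fun w z) = exp (w * Re z - w\<^sup>2 / 2)"
  by (simp add: test_fun_def)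

text \<open>Completing the square. The right side is written as the weighted modulus of the constant
  1 at a translated point, the form in which translation invariance applies.\<close>

lemma norm_test_fun_gaussian:
  "norm (test_fun w z) * exp (- (norm z)\<^sup>2 / 2) = norm (1::complex) * exp (- (norm (- of_real w + z))\<^sup>2 / 2)"
proof -
  have "w * Re z - w\<^sup>2 / 2 + - (norm z)\<^sup>2 / 2 = - (norm (- of_real w + z))\<^sup>2 / 2"
    unfolding cmod_power2 by (simp add: power2_eq_square field_simps)
  then show ?thesis by (simp only: norm_test_fun mult_exp_exp norm_one mult_1)
qed

lemma fock_norm_test_fun: "fock_norm p (test_fun w) = fock_norm p (\<lambda>z. 1)"
proof -
  define c where "c = (- of_real w :: complex)"
  have "fock_norm \<infinity> (test_fun w) = fock_norm \<infinity> (\<lambda>z. 1)"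
  proof -
    let ?h = "\<lambda>z::complex. ennreal (norm (1::complex) * exp (- (norm z)\<^sup>2 / 2))"
    have "range (\<lambda>z. ennreal (norm (test_fun w z) * exp (- (norm z)\<^sup>2 / 2))) = range (\<lambda>z. ?h (c + z))"
      by (simp only: norm_test_fun_gaussian c_def)
    also have "\<dots> = ?h ` range (\<lambda>z. c + z)" by (simp only: image_image)
    also have "range (\<lambda>z. c + z) = UNIV" by (metis surj_plus)
    finally show ?thesis by (simp add: fock_norm_def)
  qed
  moreover have "fock_integral r (test_fun w) = fock_integral r (\<lambda>z. 1)" for r
  proof -
    let ?h = "\<lambda>z::complex. ennreal ((norm (1::complex) * exp (- (norm z)\<^sup>2 / 2)) powr r)"
    have "(\<integral>\<^sup>+ z. ?h (c + z) \<partial>lborel) = (\<integral>\<^sup>+ z. ?h z \<partial>lborel)"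
      using nn_integral_distr[of "(+) c" lborel borel ?h] by (simp add: lborel_distr_plus)
    then show ?thesis
      unfolding fock_integral_eq_powr norm_test_fun_gaussian c_def by simp
  qed
  ultimately show ?thesis by (simp add: fock_norm_def)
qed

lemma test_fun_in_fock_space:
  assumes "1 \<le> p"
  shows "test_fun w \<in> fock_space p" "fnorm p (test_fun w) = fnorm p (\<lambda>z. 1)"
  using monomial_in_fock_space[OF assms, of 0]
  by (simp_all add: fock_space_def fnorm_def fock_norm_test_fun test_fun_holomorphic)

lemma fnorm_one_pos:
  assumes "1 \<le> p"
  shows "0 < fnorm p (\<lambda>z. 1)"
proof -
  have 1: "(\<lambda>z. 1) \<in> fock_space p" using monomial_in_fock_space[OF assms, of 0] by simp
  have "fock_norm p (\<lambda>z. 1) \<noteq> 0"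
    using fock_norm_eq_0_imp[OF assms, of "\<lambda>z. 1" 0] by auto
  then show ?thesis
    using ennreal_fnorm[OF 1] fnorm_nonneg[of p "\<lambda>z. 1"] by (metis ennreal_0 less_le)
qed

lemma weighted_comp_diff_test_fun:
  "weighted_comp_diff u \<psi> n (test_fun w) = (\<lambda>z. u z * (of_real w ^ n * test_fun w (\<psi> z)))"
  by (simp add: weighted_comp_diff_def higher_deriv_test_fun)

text \<open>The factor |u(z)| is common to all terms, and what remains is log-concave in the centre;
  the index \<open>i\<close> depends on \<open>z\<close>. With \<open>u = 1\<close>,
  \<open>\<psi> = id\<close> and \<open>n = 0\<close> the statement concerns the kernels themselves.
  The offset \<open>J\<close> is left free in order to discard the first few centres later.\<close>

lemma weighted_comp_diff_test_fun_dominated: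
  assumes N: "0 < N"
  shows "\<exists>i<N. (\<Sum>j<N. norm (weighted_comp_diff u \<psi> n (test_fun (real (J + j + 1))) z))
    \<le> 6 * norm (weighted_comp_diff u \<psi> n (test_fun (real (J + i + 1))) z)"
proof -
  define x where "x = Re (\<psi> z)"
  define w where "w j = real (J + j + 1)" for j
  define a where "a j = w j ^ n * exp (w j * x - (w j)\<^sup>2 / 2)" for j
  have wpos: "0 < w j" for j by (simp add: w_def)
  have norm_eq: "norm (weighted_comp_diff u \<psi> n (test_fun (w j)) z) = norm (u z) * a j" for j
    using wpos[of j] by (simp add: weighted_comp_diff_test_fun norm_mult norm_power norm_test_fun a_def x_def)
  \<comment> \<open>The second difference of \<open>w * x - w\<^sup>2 / 2\<close> is \<open>-1\<close>, and \<open>w ^ n\<close> is log-concave.\<close>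
  have half: "exp (- 1 :: real) \<le> 1 / 2"
    using exp_ge_add_one_self[of "1::real"] by (simp add: exp_minus field_simps)
  obtain i where i: "i < N" "(\<Sum>j<N. a j) \<le> 6 * a i"
  proof (rule sum_le_max_of_strongly_log_concave[OF _ _ N])
    show "0 < a k" for k using wpos[of k] by (simp add: a_def)
    show "a (k + 2) * a k \<le> (a (k + 1))\<^sup>2 / 2" for k
    proof -
      have w: "w (k + 2) = w (k + 1) + 1" "w k = w (k + 1) - 1" by (simp_all add: w_def)
      have "a (k + 2) * a k = (w (k + 2) * w k) ^ n
          * exp ((w (k + 2) * x - (w (k + 2))\<^sup>2 / 2) + (w k * x - (w k)\<^sup>2 / 2))"
        by (simp add: a_def power_mult_distrib exp_add mult_ac)
      also have "(w (k + 2) * x - (w (k + 2))\<^sup>2 / 2) + (w k * x - (w k)\<^sup>2 / 2)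
          = 2 * (w (k + 1) * x - (w (k + 1))\<^sup>2 / 2) + (- 1)"
        unfolding w by (simp add: power2_eq_square field_simps)
      also have "(w (k + 2) * w k) ^ n * exp (\<dots>)
          \<le> ((w (k + 1))\<^sup>2) ^ n * exp (2 * (w (k + 1) * x - (w (k + 1))\<^sup>2 / 2) + (- 1))"
      proof (intro mult_right_mono power_mono)
        show "w (k + 2) * w k \<le> (w (k + 1))\<^sup>2" unfolding w by (simp add: power2_eq_square algebra_simps)
      qed (use wpos[of k] wpos[of "k + 2"] in auto)
      also have "\<dots> = (a (k + 1))\<^sup>2 * exp (- 1)"
        unfolding exp_add exp_double a_def by (simp add: power_mult_distrib flip: power_mult) (simp add: mult.commute)
      also have "\<dots> \<le> (a (k + 1))\<^sup>2 * (1 / 2)" by (intro mult_left_mono half) simp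
      finally show ?thesis by simp
    qed
  qed
  have "norm (u z) * (\<Sum>j<N. a j) \<le> norm (u z) * (6 * a i)" by (intro mult_left_mono i) simp
  then show ?thesis
    using i(1) unfolding w_def[symmetric] norm_eq by (intro exI[of _ i]) (simp add: sum_distrib_left)
qed

section \<open>Upper and lower bounds for signed sums\<close>

lemma fock_integral_eq_fnorm:
  assumes p: "1 \<le> p" "p \<noteq> \<infinity>" and f: "f \<in> fock_space p"
  shows "fock_integral (enn2real p) f = ennreal (fnorm p f powr enn2real p)"
proof -
  have r: "1 \<le> enn2real p" using enn2real_ge_1[OF p] .
  have fin: "fock_integral (enn2real p) f \<noteq> \<infinity>"
    using f p by (auto simp: fock_space_def fock_norm_def)
  then obtain t where t: "0 \<le> t" "fock_integral (enn2real p) f = ennreal t"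
    by (cases "fock_integral (enn2real p) f") (auto simp: infinity_ennreal_def)
  then have "fnorm p f = t powr (1 / enn2real p)"
    using p fin by (simp add: fnorm_def fock_norm_def)
  then show ?thesis using t r by (simp add: powr_powr)
qed

text \<open>The two index sets may have different types: a single function is compared with a family
  over \<open>{..<N}\<close>, and such a family with one indexed by all choices of signs.\<close>

lemma sum_fock_integral_le:
  assumes r: "0 < r" and c: "0 \<le> c"
    and meas: "\<And>i. i \<in> A \<Longrightarrow> f i \<in> borel_measurable borel" "\<And>i. i \<in> B \<Longrightarrow> g i \<in> borel_measurable borel"
    and le: "\<And>z. (\<Sum>i\<in>A. norm (f i z) powr r) \<le> c * (\<Sum>i\<in>B. norm (g i z) powr r)"
  shows "(\<Sum>i\<in>A. fock_integral r (f i)) \<le> ennreal c * (\<Sum>i\<in>B. fock_integral r (g i))"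
proof -
  let ?w = "\<lambda>z::complex. exp (- (r / 2) * (norm z)\<^sup>2)"
  have sum_eq: "(\<Sum>i\<in>I. fock_integral r (h i)) =
      ennreal (r / (2 * pi)) * (\<integral>\<^sup>+ z. ennreal ((\<Sum>i\<in>I. norm (h i z) powr r) * ?w z) \<partial>lborel)"
    if "\<And>i. i \<in> I \<Longrightarrow> h i \<in> borel_measurable borel" for I and h :: "'c \<Rightarrow> complex \<Rightarrow> complex"
  proof -
    have "(\<integral>\<^sup>+ z. ennreal ((\<Sum>i\<in>I. norm (h i z) powr r) * ?w z) \<partial>lborel)
      = (\<integral>\<^sup>+ z. (\<Sum>i\<in>I. ennreal (norm (h i z) powr r * ?w z)) \<partial>lborel)"
      by (simp add: sum_distrib_right sum_ennreal)
    also have "\<dots> = (\<Sum>i\<in>I. \<integral>\<^sup>+ z. ennreal (norm (h i z) powr r * ?w z) \<partial>lborel)"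
      by (intro nn_integral_sum) (use that in measurable)
    finally show ?thesis by (simp add: fock_integral_def sum_distrib_left)
  qed
  have "(\<Sum>i\<in>A. fock_integral r (f i))
      = ennreal (r / (2 * pi)) * (\<integral>\<^sup>+ z. ennreal ((\<Sum>i\<in>A. norm (f i z) powr r) * ?w z) \<partial>lborel)"
    by (rule sum_eq[OF meas(1)])
  also have "\<dots> \<le> ennreal (r / (2 * pi)) *
      (\<integral>\<^sup>+ z. ennreal c * ennreal ((\<Sum>i\<in>B. norm (g i z) powr r) * ?w z) \<partial>lborel)"
  proof (intro mult_left_mono nn_integral_mono)
    fix z
    have "(\<Sum>i\<in>A. norm (f i z) powr r) * ?w z \<le> c * (\<Sum>i\<in>B. norm (g i z) powr r) * ?w z"
      by (intro mult_right_mono le) simp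
    then show "ennreal ((\<Sum>i\<in>A. norm (f i z) powr r) * ?w z)
        \<le> ennreal c * ennreal ((\<Sum>i\<in>B. norm (g i z) powr r) * ?w z)"
      using c by (simp add: ennreal_leI mult.assoc sum_nonneg flip: ennreal_mult)
  qed simp
  also have "\<dots> = ennreal c * (ennreal (r / (2 * pi)) *
      (\<integral>\<^sup>+ z. ennreal ((\<Sum>i\<in>B. norm (g i z) powr r) * ?w z) \<partial>lborel))"
    using meas(2) by (subst nn_integral_cmult) (auto simp: mult_ac)
  also have "\<dots> = ennreal c * (\<Sum>i\<in>B. fock_integral r (g i))"
    by (subst sum_eq[OF meas(2)]) auto
  finally show ?thesis .
qed

text \<open>A choice of signs is encoded by the set of indices with sign +1, so that averaging over
  the choices for \<open>N\<close> terms is a sum over \<open>Pow {..<N}\<close>.\<close>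

definition pm_sign :: "nat set \<Rightarrow> nat \<Rightarrow> complex" where
  "pm_sign S j = (if j \<in> S then 1 else - 1)"

lemma norm_pm_sign [simp]: "norm (pm_sign S j) = 1"
  by (simp add: pm_sign_def)

text \<open>For \<open>p = \<infinity>\<close> the exponent is \<open>1 / enn2real \<infinity> = 1 / 0 = 0\<close>, as it should be.\<close>

lemma fnorm_signed_sum_le:
  assumes p: "1 \<le> p" and N: "0 < N" and K: "0 \<le> K" and C: "0 \<le> C"
    and g: "\<And>j. g j \<in> fock_space p" "\<And>j. fnorm p (g j) \<le> C"
    and dom: "\<And>z. \<exists>i<N. (\<Sum>j<N. norm (g j z)) \<le> K * norm (g i z)"
  shows "fnorm p (\<lambda>z. \<Sum>j<N. pm_sign S j * g j z) \<le> K * C * real N powr (1 / enn2real p)"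
proof -
  define F where "F = (\<lambda>z. \<Sum>j<N. pm_sign S j * g j z)"
  have F: "F \<in> fock_space p"
    unfolding F_def by (intro fock_space_sum fock_space_cmult p g) simp
  have dom': "\<exists>i<N. norm (F z) \<le> K * norm (g i z)" for z
  proof -
    have "norm (F z) \<le> (\<Sum>j<N. norm (g j z))"
      unfolding F_def by (rule order_trans[OF norm_sum]) (simp add: norm_mult)
    then show ?thesis using dom[of z] by (meson order_trans)
  qed
  have nonneg: "0 \<le> K * C * real N powr (1 / enn2real p)" using K C by simp
  have "fock_norm p F \<le> ennreal (K * C * real N powr (1 / enn2real p))"
  proof (cases "p = \<infinity>")
    case True
    have "norm (F z) * exp (- (1 / 2) * (norm z)\<^sup>2) \<le> K * C" for z
    proof -
      obtain i where i: "norm (F z) \<le> K * norm (g i z)" using dom' by blast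
      have "ennreal (norm (g i z) * exp (- (1 / 2) * (norm z)\<^sup>2)) \<le> fock_norm p (g i)"
        unfolding fock_norm_def using True by (auto intro: SUP_upper)
      also have "\<dots> \<le> ennreal C" using g by (simp add: ennreal_leI flip: ennreal_fnorm)
      finally have "norm (g i z) * exp (- (1 / 2) * (norm z)\<^sup>2) \<le> C"
        using C by (simp add: ennreal_le_iff)
      then have "K * (norm (g i z) * exp (- (1 / 2) * (norm z)\<^sup>2)) \<le> K * C"
        using K by (rule mult_left_mono)
      moreover have "norm (F z) * exp (- (1 / 2) * (norm z)\<^sup>2) \<le> K * (norm (g i z) * exp (- (1 / 2) * (norm z)\<^sup>2))"
        unfolding mult.assoc[symmetric] by (intro mult_right_mono i) simp
      ultimately show ?thesis by (rule order_trans[rotated])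
    qed
    then show ?thesis
      unfolding fock_norm_def using True N by (auto intro!: SUP_least ennreal_leI)
  next
    case False
    define r where "r = enn2real p"
    have r: "1 \<le> r" unfolding r_def using enn2real_ge_1[OF p False] .
    have "(\<Sum>i\<in>{()}. fock_integral r F) \<le> ennreal (K powr r) * (\<Sum>j<N. fock_integral r (g j))"
    proof (rule sum_fock_integral_le)
      fix z
      obtain i where i: "i < N" "norm (F z) \<le> K * norm (g i z)" using dom' by blast
      have "norm (F z) powr r \<le> K powr r * norm (g i z) powr r"
        using powr_mono2[OF _ _ i(2), of r] r K by (simp add: powr_mult)
      \<comment> \<open>The dominating index varies with \<open>z\<close>. Bounding its term by the
        whole sum removes that dependence and produces the factor \<open>N\<close> under the r-th
        root.\<close>
      also have "\<dots> \<le> K powr r * (\<Sum>j<N. norm (g j z) powr r)"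
        using i by (intro mult_left_mono member_le_sum) auto
      finally show "(\<Sum>i\<in>{()}. norm (F z) powr r) \<le> K powr r * (\<Sum>j<N. norm (g j z) powr r)" by simp
    qed (use r F g fock_space_measurable in auto)
    also have "\<dots> = ennreal (K powr r) * (\<Sum>j<N. ennreal (fnorm p (g j) powr r))"
      unfolding r_def using fock_integral_eq_fnorm[OF p False] g by simp
    also have "\<dots> \<le> ennreal (K powr r) * (\<Sum>j<N. ennreal (C powr r))"
      using r g C by (intro mult_left_mono sum_mono ennreal_leI powr_mono2) auto
    also have "\<dots> = ennreal (K powr r * (real N * C powr r))"
      by (simp add: ennreal_mult ennreal_of_nat_eq_real_of_nat)
    also have "K powr r * (real N * C powr r) = (K * C * real N powr (1 / r)) powr r"
      using K C r by (simp add: powr_mult powr_powr)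
    finally show ?thesis
      using fock_norm_le_iff[OF False p nonneg] by (simp add: r_def)
  qed
  then show ?thesis
    using fnormI(2)[OF fock_space_holomorphic[OF F] _ nonneg] by (simp add: F_def)
qed

text \<open>Flipping the sign of \<open>a i\<close> changes the sum by \<open>2 * a i\<close>, so one of the two sums is at least \<open>norm (a i)\<close>.\<close>

lemma norm_powr_le_sum_signs:
  fixes a :: "nat \<Rightarrow> complex"
  assumes i: "i < N" and r: "0 < r"
  shows "2 ^ N * norm (a i) powr r \<le> 2 * (\<Sum>S\<in>Pow {..<N}. norm (\<Sum>j<N. pm_sign S j * a j) powr r)"
proof -
  define F where "F S = (\<Sum>j<N. pm_sign S j * a j)" for S
  \<comment> \<open>Flips the sign at \<open>i\<close>. As an involution of the power set it leaves
    sums over all sign choices unchanged.\<close>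
  define \<phi> where "\<phi> S = (if i \<in> S then S - {i} else insert i S)" for S
  have bij: "bij_betw \<phi> (Pow {..<N}) (Pow {..<N})"
    by (rule bij_betw_byWitness[where f' = \<phi>]) (use i in \<open>auto simp: \<phi>_def split: if_splits\<close>)
  have pt: "norm (a i) powr r \<le> norm (F S) powr r + norm (F (\<phi> S)) powr r" for S
  proof -
    have "F S - F (\<phi> S) = (\<Sum>j<N. (pm_sign S j - pm_sign (\<phi> S) j) * a j)"
      by (simp add: F_def left_diff_distrib sum_subtractf)
    also have "\<dots> = (\<Sum>j<N. if j = i then 2 * pm_sign S i * a i else 0)"
    proof (intro sum.cong refl)
      fix j
      show "(pm_sign S j - pm_sign (\<phi> S) j) * a j = (if j = i then 2 * pm_sign S i * a i else 0)"
        by (cases "j = i"; cases "i \<in> S") (simp_all add: pm_sign_def \<phi>_def)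
    qed
    also have "\<dots> = 2 * pm_sign S i * a i" using i by simp
    finally have "2 * norm (a i) = norm (F S - F (\<phi> S))" by (simp add: norm_mult)
    also have "\<dots> \<le> norm (F S) + norm (F (\<phi> S))" by (rule norm_triangle_ineq4)
    finally have "norm (a i) \<le> norm (F S) \<or> norm (a i) \<le> norm (F (\<phi> S))" by linarith
    then show ?thesis
    proof
      assume "norm (a i) \<le> norm (F S)"
      then have "norm (a i) powr r \<le> norm (F S) powr r" using r by (intro powr_mono2) auto
      then show ?thesis by (simp add: add_increasing2)
    next
      assume "norm (a i) \<le> norm (F (\<phi> S))"
      then have "norm (a i) powr r \<le> norm (F (\<phi> S)) powr r" using r by (intro powr_mono2) auto
      then show ?thesis by (simp add: add_increasing)
    qed
  qed
  have "2 ^ N * norm (a i) powr r = (\<Sum>S\<in>Pow {..<N}. norm (a i) powr r)"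
    by (simp add: card_Pow)
  also have "\<dots> \<le> (\<Sum>S\<in>Pow {..<N}. norm (F S) powr r + norm (F (\<phi> S)) powr r)"
    by (intro sum_mono pt)
  also have "\<dots> = 2 * (\<Sum>S\<in>Pow {..<N}. norm (F S) powr r)"
    using sum.reindex_bij_betw[OF bij, of "\<lambda>S. norm (F S) powr r"] by (simp add: sum.distrib)
  finally show ?thesis by (simp add: F_def)
qed

text \<open>Write x^r = x x^(r-1) and bound the second factor by that of the whole sum.\<close>

lemma sum_powr_le_powr_sum:
  fixes x :: "'i \<Rightarrow> real"
  assumes "finite A" "\<And>i. i \<in> A \<Longrightarrow> 0 \<le> x i" "1 \<le> r"
  shows "(\<Sum>i\<in>A. x i powr r) \<le> (\<Sum>i\<in>A. x i) powr r"
proof -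
  let ?s = "\<Sum>i\<in>A. x i"
  have s: "0 \<le> ?s" using assms by (intro sum_nonneg) auto
  have eq: "y powr r = y * y powr (r - 1)" if "0 \<le> y" for y :: real
    using that assms(3) powr_add[of y 1 "r - 1"] by (cases "y = 0") auto
  have "(\<Sum>i\<in>A. x i powr r) = (\<Sum>i\<in>A. x i * x i powr (r - 1))"
    using assms eq by (intro sum.cong) auto
  also have "\<dots> \<le> (\<Sum>i\<in>A. x i * ?s powr (r - 1))"
    using assms by (intro sum_mono mult_left_mono powr_mono2 member_le_sum) auto
  also have "\<dots> = ?s powr r" using eq[OF s] by (simp add: sum_distrib_right)
  finally show ?thesis .
qed

text \<open>At each point the sum of the moduli is at most \<open>K\<close> times one of them, and
  the r-th power of that one is at most twice the average over all signs of the r-th power of the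
  signed sum. Integration shows that the signed sums cannot all have small norm.\<close>

lemma fnorm_signed_sum_ge:
  assumes p: "1 \<le> p" "p \<noteq> \<infinity>" and N: "0 < N" and K: "0 < K" and c: "0 < c"
    and g: "\<And>j. g j \<in> fock_space p" "\<And>j. c \<le> fnorm p (g j)"
    and dom: "\<And>z. \<exists>i<N. (\<Sum>j<N. norm (g j z)) \<le> K * norm (g i z)"
  obtains S where "c / (4 * K) * real N powr (1 / enn2real p) \<le> fnorm p (\<lambda>z. \<Sum>j<N. pm_sign S j * g j z)"
proof (rule ccontr)
  assume "\<not> thesis"
  define r where "r = enn2real p"
  have r: "1 \<le> r" unfolding r_def using enn2real_ge_1[OF p] .
  define F where "F S = (\<lambda>z. \<Sum>j<N. pm_sign S j * g j z)" for S
  \<comment> \<open>If all norms were below \<open>t\<close>, averaging would give N c^r <= 2 (K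
    t)^r = 2 (1/4)^r N c^r. The 4 makes the factor 2 (1/4)^r at most 1/2 for every exponent r >=
    1.\<close>
  define t where "t = c / (4 * K) * real N powr (1 / r)"
  have F: "F S \<in> fock_space p" for S
    unfolding F_def by (intro fock_space_sum fock_space_cmult p g) simp
  have less: "fnorm p (F S) < t" for S
    using that[of S] \<open>\<not> thesis\<close> unfolding F_def t_def r_def by fastforce
  have t: "0 \<le> t" using c K by (simp add: t_def)
  define c1 where "c1 = K powr r * 2 / 2 ^ N"
  have c1: "0 \<le> c1" by (simp add: c1_def)
  have "(\<Sum>j<N. fock_integral r (g j)) \<le> ennreal c1 * (\<Sum>S\<in>Pow {..<N}. fock_integral r (F S))"
  proof (rule sum_fock_integral_le)
    fix z
    obtain i where i: "i < N" "(\<Sum>j<N. norm (g j z)) \<le> K * norm (g i z)" using dom by blast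
    have "(\<Sum>j<N. norm (g j z) powr r) \<le> (\<Sum>j<N. norm (g j z)) powr r"
      using r by (intro sum_powr_le_powr_sum) auto
    also have "\<dots> \<le> (K * norm (g i z)) powr r"
      using i r by (intro powr_mono2 sum_nonneg) auto
    also have "\<dots> = K powr r / 2 ^ N * (2 ^ N * norm (g i z) powr r)"
      using K by (simp add: powr_mult)
    also have "\<dots> \<le> K powr r / 2 ^ N * (2 * (\<Sum>S\<in>Pow {..<N}. norm (F S z) powr r))"
      unfolding F_def using i r by (intro mult_left_mono norm_powr_le_sum_signs) auto
    finally show "(\<Sum>j<N. norm (g j z) powr r) \<le> c1 * (\<Sum>S\<in>Pow {..<N}. norm (F S z) powr r)"
      by (simp add: c1_def)
  qed (use r c1 g F fock_space_measurable in auto)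
  then have "(\<Sum>j<N. ennreal (fnorm p (g j) powr r)) \<le> ennreal c1 * (\<Sum>S\<in>Pow {..<N}. ennreal (fnorm p (F S) powr r))"
    using fock_integral_eq_fnorm[OF p] g F by (simp add: r_def)
  then have "(\<Sum>j<N. fnorm p (g j) powr r) \<le> c1 * (\<Sum>S\<in>Pow {..<N}. fnorm p (F S) powr r)"
    using c1 by (simp add: sum_ennreal sum_nonneg ennreal_le_iff flip: ennreal_mult)
  moreover have "(\<Sum>j<N. c powr r) \<le> (\<Sum>j<N. fnorm p (g j) powr r)"
    using c g r by (intro sum_mono powr_mono2) auto
  moreover have "c1 * (\<Sum>S\<in>Pow {..<N}. fnorm p (F S) powr r) \<le> c1 * (\<Sum>S\<in>Pow {..<N}. t powr r)"
    using c1 r less by (intro mult_left_mono sum_mono powr_mono2) (auto intro: less_imp_le)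
  ultimately have "real N * c powr r \<le> 2 * K powr r * t powr r"
    by (simp add: c1_def card_Pow)
  also have "\<dots> = 2 * (K * t) powr r" using K t by (simp add: powr_mult)
  also have "K * t = (1 / 4) * (c * real N powr (1 / r))" using K by (simp add: t_def)
  also have "2 * \<dots> powr r = 2 * (1 / 4) powr r * (real N * c powr r)"
    using c r by (simp add: powr_mult powr_divide powr_powr)
  also have "\<dots> < 1 * (real N * c powr r)"
  proof (intro mult_strict_right_mono)
    have "(1 / 4 :: real) powr r \<le> (1 / 4) powr 1" using r by (intro powr_mono') auto
    then show "2 * (1 / 4 :: real) powr r < 1" by simp
    show "0 < real N * c powr r" using N c by simp
  qed
  finally show False by simp
qed

section \<open>Comparison of the growth exponents\<close>

lemma weighted_comp_diff_sum:
  assumes "finite A" "\<And>i. i \<in> A \<Longrightarrow> f i holomorphic_on UNIV"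
  shows "weighted_comp_diff u \<psi> n (\<lambda>z. \<Sum>i\<in>A. c i * f i z) =
    (\<lambda>z. \<Sum>i\<in>A. c i * weighted_comp_diff u \<psi> n (f i) z)"
  using assms
proof (induction A rule: finite_induct)
  case (insert x A)
  have "(\<lambda>z. \<Sum>i\<in>A. c i * f i z) holomorphic_on UNIV" "(\<lambda>z. c x * f x z) holomorphic_on UNIV"
    using insert.prems by (auto intro!: holomorphic_intros)
  then show ?case
    using insert by (simp add: weighted_comp_diff_add weighted_comp_diff_cmult)
qed (simp add: weighted_comp_diff_zero)

text \<open>The i-th derivative at 0 is w^i exp(-w^2/2), which decays faster than any power of w.
  The rate 1/w^2 is chosen because it is summable over integer centres.\<close>

lemma test_fun_derivatives_bound:
  obtains B where "0 \<le> B"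
    "\<And>w. 1 \<le> w \<Longrightarrow> (\<Sum>i<n. norm ((deriv ^^ i) (test_fun w) 0)) \<le> B / w\<^sup>2"
proof -
  \<comment> \<open>Taken from the term of index \<open>i + 2\<close> in the series of exp(w^2/2),
    whose power of w exceeds w^(i+2) for w >= 1.\<close>
  define b :: "nat \<Rightarrow> real" where "b i = 2 ^ (i + 2) * fact (i + 2)" for i
  show ?thesis
  proof (rule that[of "\<Sum>i<n. b i"])
    show "0 \<le> (\<Sum>i<n. b i)" by (intro sum_nonneg) (simp add: b_def)
    fix w :: real assume w: "1 \<le> w"
    have "norm ((deriv ^^ i) (test_fun w) 0) \<le> b i / w\<^sup>2" for i
    proof -
      have "(w\<^sup>2 / 2) ^ (i + 2) / fact (i + 2) \<le> exp (w\<^sup>2 / 2)"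
        by (rule power_div_fact_le_exp) simp
      then have "(w\<^sup>2) ^ (i + 2) \<le> b i * exp (w\<^sup>2 / 2)"
        by (simp add: b_def power_divide divide_le_eq mult_ac)
      moreover have "w ^ i * w\<^sup>2 \<le> (w\<^sup>2) ^ (i + 2)"
        using power_increasing[of "i + 2" "2 * (i + 2)" w] w by (simp only: power_add power_mult) simp
      ultimately have "w ^ i * w\<^sup>2 \<le> b i * exp (w\<^sup>2 / 2)" by linarith
      then have "w ^ i * exp (- (w\<^sup>2 / 2)) \<le> b i / w\<^sup>2"
        using w by (simp add: exp_minus field_simps)
      then show ?thesis
        using w by (simp add: higher_deriv_test_fun norm_mult norm_power norm_test_fun)
    qed
    then have "(\<Sum>i<n. norm ((deriv ^^ i) (test_fun w) 0)) \<le> (\<Sum>i<n. b i / w\<^sup>2)" by (intro sum_mono)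
    then show "(\<Sum>i<n. norm ((deriv ^^ i) (test_fun w) 0)) \<le> (\<Sum>i<n. b i) / w\<^sup>2"
      by (simp add: sum_divide_distrib)
  qed
qed

lemma exponent_le_of_powr_bound:
  fixes \<alpha> \<beta> c B :: real
  assumes c: "0 < c" and le: "\<And>N. 0 < N \<Longrightarrow> c * real N powr \<alpha> \<le> B * real N powr \<beta>"
  shows "\<alpha> \<le> \<beta>"
proof (rule ccontr)
  assume "\<not> \<alpha> \<le> \<beta>"
  then have d: "0 < \<alpha> - \<beta>" by simp
  \<comment> \<open>Beyond \<open>X\<close> the power with exponent
    \<open>\<alpha> - \<beta>\<close> exceeds \<open>\<bar>B\<bar> / c\<close>; the added 1 keeps
    the base positive and the inequality strict.\<close>
  define X where "X = (\<bar>B\<bar> / c + 1) powr (1 / (\<alpha> - \<beta>))"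
  have pos: "0 < \<bar>B\<bar> / c + 1" using c by (simp add: add_nonneg_pos)
  obtain N where N: "X < real N" using reals_Archimedean2 by blast
  have X: "0 \<le> X" "X powr (\<alpha> - \<beta>) = \<bar>B\<bar> / c + 1"
    using pos d by (auto simp: X_def powr_powr)
  then have N0: "0 < real N" using N by linarith
  have "\<bar>B\<bar> / c < real N powr (\<alpha> - \<beta>)"
    using powr_mono2[of "\<alpha> - \<beta>" X "real N"] X N d by simp
  then have "\<bar>B\<bar> < c * real N powr (\<alpha> - \<beta>)" using c by (simp add: field_simps)
  then have "\<bar>B\<bar> * real N powr \<beta> < c * real N powr (\<alpha> - \<beta>) * real N powr \<beta>"
    using N0 by (intro mult_strict_right_mono) auto
  also have "\<dots> = c * real N powr \<alpha>" by (simp add: mult.assoc flip: powr_add)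
  also have "\<dots> \<le> B * real N powr \<beta>" using le[of N] N0 by simp
  also have "\<dots> \<le> \<bar>B\<bar> * real N powr \<beta>" by (intro mult_right_mono) auto
  finally show False by simp
qed

text \<open>\<open>enn2real\<close> maps \<infinity> to 0 and every other admissible exponent to at
  least 1, so the reciprocals still tell the infinite exponent apart.\<close>

lemma exponent_eq_of_inverse_eq:
  assumes p: "1 \<le> p" and q: "1 \<le> q" and eq: "1 / enn2real p = 1 / enn2real q"
  shows "p = q"
proof -
  have eq': "enn2real p = enn2real q" using eq by (metis inverse_eq_divide inverse_inverse_eq)
  show ?thesis
  proof (cases "p = \<infinity> \<or> q = \<infinity>")
    case True
    then show ?thesis
      using eq' enn2real_ge_1[OF p] enn2real_ge_1[OF q]
      by (cases "p = \<infinity>"; cases "q = \<infinity>") (simp_all add: infinity_ennreal_def)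
  next
    case False
    then show ?thesis using eq' by (metis ennreal_enn2real infinity_ennreal_def less_top)
  qed
qed

theorem proposition1p9:
  fixes u \<psi> :: "complex \<Rightarrow> complex" and p q :: ennreal and n :: nat
  assumes "u holomorphic_on UNIV" and "\<psi> holomorphic_on UNIV"
    and "\<exists>z. u z \<noteq> 0" and "\<not> \<psi> constant_on UNIV"
    and "1 \<le> p" and "1 \<le> q"
    and "fock_bounded p q (weighted_comp_diff u \<psi> n)"
    and "fock_closed_range p q (weighted_comp_diff u \<psi> n)"
  shows "p = q"
proof -
  note p = assms(5) and q = assms(6)
  define T where "T = weighted_comp_diff u \<psi> n"
  define G where "G = fnorm p (\<lambda>z. 1)"
  have G: "0 < G" unfolding G_def by (rule fnorm_one_pos[OF p])
  have T_in: "T f \<in> fock_space q" if "f \<in> fock_space p" for f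
    using assms(7) that by (auto simp: fock_bounded_def T_def)
  obtain C where C: "0 \<le> C" "\<And>f. f \<in> fock_space p \<Longrightarrow> fnorm q (T f) \<le> C * fnorm p f"
  proof -
    obtain C where C: "\<forall>f\<in>fock_space p. fock_norm q (T f) \<le> ennreal C * fock_norm p f"
      using assms(7) by (auto simp: fock_bounded_def T_def)
    \<comment> \<open>\<open>fock_bounded\<close> admits any real constant, and
      \<open>ennreal\<close> truncates negative ones to 0.\<close>
    have "fnorm q (T f) \<le> max C 0 * fnorm p f" if f: "f \<in> fock_space p" for f
    proof -
      have "fock_norm q (T f) \<le> ennreal C * fock_norm p f" using C f by blast
      also have "\<dots> \<le> ennreal (max C 0) * fock_norm p f"
        by (intro mult_right_mono ennreal_leI) auto
      finally have "ennreal (fnorm q (T f)) \<le> ennreal (max C 0) * ennreal (fnorm p f)"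
        using f T_in[OF f] by (simp add: ennreal_fnorm)
      then show ?thesis by (simp add: ennreal_le_iff flip: ennreal_mult)
    qed
    then show ?thesis by (intro that[of "max C 0"]) auto
  qed
  obtain D where D: "0 < D" "\<And>f. f \<in> fock_space p \<Longrightarrow>
      fnorm p f \<le> D * (fnorm q (T f) + (\<Sum>i<n. norm ((deriv ^^ i) f 0)))"
    using closed_range_imp_norm_bound[OF assms(1,3,2,4) p q assms(7,8)] unfolding T_def by metis
  obtain B where B: "0 \<le> B"
    "\<And>w. 1 \<le> w \<Longrightarrow> (\<Sum>i<n. norm ((deriv ^^ i) (test_fun w) 0)) \<le> B / w\<^sup>2"
    using test_fun_derivatives_bound[of n] by metis
  \<comment> \<open>Centres beyond \<open>J\<close> have Taylor terms so small that
    \<open>D * \<delta> j <= G / 2\<close>. This leaves half of \<open>G\<close> for the lower bound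
    on the norm of \<open>T (k j)\<close>.\<close>
  obtain J where J: "2 * D * B / G < real J" using reals_Archimedean2 by blast
  define w where "w j = real (J + j + 1)" for j
  define k where "k j = test_fun (w j)" for j
  define \<delta> where "\<delta> j = (\<Sum>i<n. norm ((deriv ^^ i) (k j) 0))" for j
  have w: "1 \<le> w j" "real J \<le> w j" "real (Suc j) \<le> w j" for j by (simp_all add: w_def)
  have \<delta>: "\<delta> j \<le> B / (w j)\<^sup>2" for j unfolding \<delta>_def k_def by (rule B(2)[OF w(1)])
  have k: "k j \<in> fock_space p" "fnorm p (k j) = G" for j
    unfolding k_def G_def by (rule test_fun_in_fock_space[OF p])+
  have Tk: "T (k j) \<in> fock_space q" "fnorm q (T (k j)) \<le> C * G" "G / (2 * D) \<le> fnorm q (T (k j))" for j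
  proof -
    show "T (k j) \<in> fock_space q" by (rule T_in[OF k(1)])
    show "fnorm q (T (k j)) \<le> C * G" using C(2)[OF k(1)] by (simp add: k(2))
    have "2 * D * B < G * real J" using J G by (simp add: divide_less_eq mult.commute)
    also have "\<dots> \<le> G * w j" using w(2)[of j] G by (intro mult_left_mono) auto
    also have "\<dots> \<le> G * (w j)\<^sup>2" using G w(1)[of j] by (intro mult_left_mono) (auto simp: power2_eq_square)
    finally have "2 * D * (B / (w j)\<^sup>2) \<le> G" using w(1)[of j] by (simp add: divide_le_eq)
    moreover have "D * \<delta> j \<le> D * (B / (w j)\<^sup>2)" using \<delta> D(1) by (intro mult_left_mono) auto
    moreover have "G \<le> D * fnorm q (T (k j)) + D * \<delta> j"
      using D(2)[OF k(1)[of j]] by (simp add: k(2) \<delta>_def distrib_left)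
    ultimately have "G \<le> 2 * (D * fnorm q (T (k j)))" by linarith
    then show "G / (2 * D) \<le> fnorm q (T (k j))" using D(1) by (simp add: field_simps)
  qed
  have summ: "summable (\<lambda>j. B / (real (Suc j))\<^sup>2)"
    using summable_mult[OF sums_summable[OF inverse_squares_sums], of B] by (simp add: add.commute)
  \<comment> \<open>Bounds the Taylor error of every signed sum, independently of \<open>N\<close>
    and of the signs.\<close>
  define Z where "Z = (\<Sum>j. B / (real (Suc j))\<^sup>2)"
  have Z: "0 \<le> Z" unfolding Z_def by (rule suminf_nonneg[OF summ]) (use B in simp)
  have \<delta>_sum: "(\<Sum>j<N. \<delta> j) \<le> Z" for N
  proof -
    have "(\<Sum>j<N. \<delta> j) \<le> (\<Sum>j<N. B / (real (Suc j))\<^sup>2)"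
    proof (intro sum_mono)
      fix j
      have "B / (w j)\<^sup>2 \<le> B / (real (Suc j))\<^sup>2"
        using B(1) w(3)[of j] by (intro divide_left_mono power_mono) auto
      then show "\<delta> j \<le> B / (real (Suc j))\<^sup>2" using \<delta>[of j] by linarith
    qed
    also have "\<dots> \<le> Z" unfolding Z_def using B by (intro sum_le_suminf[OF summ]) auto
    finally show ?thesis .
  qed
  define F where "F N S = (\<lambda>z. \<Sum>j<N. pm_sign S j * k j z)" for N S
  have F: "F N S \<in> fock_space p" for N S
    unfolding F_def by (intro fock_space_sum fock_space_cmult p k) simp
  have TF: "T (F N S) = (\<lambda>z. \<Sum>j<N. pm_sign S j * T (k j) z)" for N S
    unfolding F_def T_def by (intro weighted_comp_diff_sum fock_space_holomorphic[OF k(1)]) simp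
  have F_deriv: "(\<Sum>i<n. norm ((deriv ^^ i) (F N S) 0)) \<le> Z" for N S
  proof -
    \<comment> \<open>With weight 1 and symbol \<open>id\<close> the operator is the i-th
      derivative, so its linearity differentiates the sum.\<close>
    have "(deriv ^^ i) (F N S) 0 = (\<Sum>j<N. pm_sign S j * (deriv ^^ i) (k j) 0)" for i
      using weighted_comp_diff_sum[of "{..<N}" k "\<lambda>_. 1" id i "pm_sign S"] fock_space_holomorphic[OF k(1)]
      by (simp add: weighted_comp_diff_def F_def fun_eq_iff)
    then have "norm ((deriv ^^ i) (F N S) 0) \<le> (\<Sum>j<N. norm ((deriv ^^ i) (k j) 0))" for i
      using norm_sum[of "\<lambda>j. pm_sign S j * (deriv ^^ i) (k j) 0" "{..<N}"] by (simp add: norm_mult)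
    then have "(\<Sum>i<n. norm ((deriv ^^ i) (F N S) 0)) \<le> (\<Sum>i<n. \<Sum>j<N. norm ((deriv ^^ i) (k j) 0))"
      by (intro sum_mono)
    also have "\<dots> = (\<Sum>j<N. \<delta> j)" unfolding \<delta>_def by (rule sum.swap)
    finally show ?thesis using \<delta>_sum[of N] by linarith
  qed
  have dom_T: "\<exists>i<N. (\<Sum>j<N. norm (T (k j) z)) \<le> 6 * norm (T (k i) z)" if "0 < N" for N z
    unfolding T_def k_def w_def by (rule weighted_comp_diff_test_fun_dominated[OF that])
  have dom_k: "\<exists>i<N. (\<Sum>j<N. norm (k j z)) \<le> 6 * norm (k i z)" if "0 < N" for N z
    using weighted_comp_diff_test_fun_dominated[OF that, of "\<lambda>_. 1" id 0 J z]
    unfolding k_def w_def by (simp add: weighted_comp_diff_def)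
  define \<alpha> where "\<alpha> = 1 / enn2real p"
  define \<beta> where "\<beta> = 1 / enn2real q"
  have nonneg: "0 \<le> \<alpha>" "0 \<le> \<beta>" by (simp_all add: \<alpha>_def \<beta>_def)
  have "\<alpha> \<le> \<beta>"
  proof (cases "p = \<infinity>")
    case True
    then show ?thesis using nonneg by (simp add: \<alpha>_def)
  next
    case False
    show ?thesis
    proof (rule exponent_le_of_powr_bound[of "G / 24"])
      fix N :: nat assume N: "0 < N"
      \<comment> \<open>The signs depend on \<open>N\<close>, but the bound for the images that
        follows holds for every choice. The 24 is 4 times the domination constant 6.\<close>
      obtain S where S: "G / (4 * 6) * real N powr (1 / enn2real p) \<le> fnorm p (F N S)"
        unfolding F_def by (rule fnorm_signed_sum_ge[OF p False N _ G, of 6 k]) (use k dom_k[OF N] in auto)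
      have "fnorm q (T (F N S)) \<le> 6 * (C * G) * real N powr \<beta>"
        unfolding TF \<beta>_def using C(1) G Tk dom_T[OF N] by (intro fnorm_signed_sum_le[OF q N]) auto
      \<comment> \<open>A bounded error is absorbed since \<open>\<beta>\<close> is nonnegative and
        \<open>N\<close> is at least 1.\<close>
      moreover have "Z \<le> Z * real N powr \<beta>"
        using Z N nonneg ge_one_powr_ge_zero[of "real N" \<beta>] by (simp add: mult_le_cancel_left1)
      ultimately have "fnorm q (T (F N S)) + (\<Sum>i<n. norm ((deriv ^^ i) (F N S) 0))
          \<le> (6 * (C * G) + Z) * real N powr \<beta>"
        using F_deriv[where N = N and S = S] by (simp add: distrib_right)
      then have "D * (fnorm q (T (F N S)) + (\<Sum>i<n. norm ((deriv ^^ i) (F N S) 0)))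
          \<le> D * ((6 * (C * G) + Z) * real N powr \<beta>)"
        using D(1) by (intro mult_left_mono) auto
      then show "G / 24 * real N powr \<alpha> \<le> D * (6 * (C * G) + Z) * real N powr \<beta>"
        using S D(2)[OF F[where N = N and S = S]] by (simp add: \<alpha>_def mult.assoc)
    qed (use G in simp)
  qed
  \<comment> \<open>Now the signs are chosen for the images, and the upper bound for the sums of the
    \<open>k j\<close> is transported by \<open>T\<close>. The closed range enters through the lower
    bound \<open>G / (2 * D)\<close> for the single images.\<close>
  moreover have "\<beta> \<le> \<alpha>"
  proof (cases "q = \<infinity>")
    case True
    then show ?thesis using nonneg by (simp add: \<beta>_def)
  next
    case False
    show ?thesis
    proof (rule exponent_le_of_powr_bound[of "G / (2 * D) / 24"])
      fix N :: nat assume N: "0 < N"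
      obtain S where S: "G / (2 * D) / (4 * 6) * real N powr (1 / enn2real q) \<le> fnorm q (T (F N S))"
        unfolding TF by (rule fnorm_signed_sum_ge[OF q False N, of 6 "G / (2 * D)" "\<lambda>j. T (k j)"])
          (use Tk dom_T[OF N] D G in auto)
      have "fnorm p (F N S) \<le> 6 * G * real N powr \<alpha>"
        unfolding F_def \<alpha>_def using G k dom_k[OF N] by (intro fnorm_signed_sum_le[OF p N]) auto
      then have "C * fnorm p (F N S) \<le> C * (6 * G * real N powr \<alpha>)"
        using C(1) by (rule mult_left_mono)
      then show "G / (2 * D) / 24 * real N powr \<beta> \<le> C * 6 * G * real N powr \<alpha>"
        using S C(2)[OF F[where N = N and S = S]] by (simp add: \<beta>_def mult.assoc)
    qed (use G D in simp)
  qed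
  ultimately have "\<alpha> = \<beta>" by simp
  then show ?thesis
    unfolding \<alpha>_def \<beta>_def by (rule exponent_eq_of_inverse_eq[OF p q])
qed

end
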